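(* Assume that $\widetilde{A_j}>0$ for all $j\in\{1,\dots,L-1\}$, where $$\widetilde{A_j}:=\frac{\mu_jN_je^{-\mu_j\tau_j}-(1-e^{-\mu_j\tau_j})\,C_{j+1}}{\mu_j}.$$ Then there exists a unique stationary state of the system $$\partial_t\rho_L+\partial_s\rho_L+\mu_L\rho_L=0,\qquad \rho_L(t,s=0)=\mu_LN_L,$$ $$\partial_t\rho_j+\partial_s\rho_j+\mu_j\rho_j+\frac{C_{j+1}}{A_j(t)}\,\mathbb{I}_{s\ge\tau_j}\,\rho_j=0,\qquad \rho_j(t,s=0)=\mu_jN_j+C_{j+1},\qquad 1\le j\le L-1,$$ and it is given by $$\widetilde{\rho_L}(s)=\mu_LN_Le^{-\mu_Ls},\qquad \widetilde{\rho_j}(s)=e^{-\mu_js-\frac{C_{j+1}}{\widetilde{A_j}}(s-\tau_j)_+}\left(\mu_jN_j+C_{j+1}\right)\quad(1\le j\le L-1).$$ Moreover, for initial data $\rho_j^0\in L^1(\mathbb{R}^+)$, $1\le j\le L$, such that for all $t\in[0,\tau_j]$ $$e^{-t\mu_j}\int_t^{\tau_j}\rho_j^0(s-t)\,ds+\frac{1}{\mu_j}\left(1-e^{-\mu_jt}\right)\left(\mu_jN_j+C_{j+1}\right)<N_j,$$ there is a constant $C$ such that for all $j\in\{1,\dots,L\}$ and all $t\ge\max_j\tau_j$, the solution with $\rho_j(0,\cdot)=\rho_j^0$ satisfies $$\int_0^{+\infty}|\rho_j(t,s)-\widetilde{\rho_j}(s)|\,ds\le C\,e^{-\mu_jt}\int_0^{+\infty}|\rho_j(0,s)-\widetilde{\rho_j}(s)|\,ds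 .$$
   Context: $L\ge2$ is an integer (number of hierarchical job levels). For $1\le j\le L$, the parameters $N_j>0$ (size of job class $j$), $\mu_j>0$ (turnover rate) and $\tau_j\ge0$ (minimal waiting time before promotion) are given constants, and $\alpha_j\ge1$ are given constants ($\alpha_j-1$ is the ratio of external over internal hires at level $j$). $\rho_j(t,s)$, $t\ge0$, $s\ge0$, is the density of workers in job $j$ at time $t$ with seniority $s$. Notation: $\mathbb{I}$ is the indicator function, $(x)_+=\max(x,0)$, $$A_j(t)=\int_{\tau_j}^{+\infty}\rho_j(t,s)\,ds,\qquad C_j:=\sum_{l=j}^{L}\mu_lN_l\prod_{k=j}^{l}\frac{1}{\alpha_k}\quad(1\le j\le L),\qquad C_{L+1}:=0 .$$ Standing assumptions on the initial data: $\rho_j^0(s)>0$ and $\int_0^{+\infty}\rho_j^0(s)\,ds=N_j$. Solutions are weak solutions in $C([0,\infty);L^1(\mathbb{R}^+))$ (integration along characteristics) with $A_j(t)>0$ for $1\le j\le L-1$. A stationary state is a time-independent nonnegative integrable solution of the system (with $A_j>0$ for $1\le j\le L-1$). *)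

theory Defs
  imports "HOL-Analysis.Analysis"
begin

text \<open>
  Job levels are indexed by \<open>j \<in> {1..L}\<close>; the parameters \<open>\<mu>\<close>, \<open>N\<close>, \<open>\<tau>\<close>, \<open>\<alpha>\<close> are functions of
  the level.  A family of densities is \<open>\<rho> j t s\<close> with time \<open>t \<ge> 0\<close> and seniority \<open>s \<ge> 0\<close>;
  values at negative arguments are irrelevant throughout.
\<close>

definition Cst :: "nat \<Rightarrow> (nat \<Rightarrow> real) \<Rightarrow> (nat \<Rightarrow> real) \<Rightarrow> (nat \<Rightarrow> real) \<Rightarrow> nat \<Rightarrow> real" where
  \<comment> \<open>At \<open>j = L + 1\<close> the sum is empty, which gives the convention that this constant is 0.\<close>
  "Cst L \<mu> N \<alpha> j = (\<Sum>l=j..L. \<mu> l * N l * (\<Prod>k=j..l. 1 / \<alpha> k))"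

definition A_tilde ::
    "nat \<Rightarrow> (nat \<Rightarrow> real) \<Rightarrow> (nat \<Rightarrow> real) \<Rightarrow> (nat \<Rightarrow> real) \<Rightarrow> (nat \<Rightarrow> real) \<Rightarrow> nat \<Rightarrow> real" where
  "A_tilde L \<mu> N \<tau> \<alpha> j =
     (\<mu> j * N j * exp (- \<mu> j * \<tau> j) - (1 - exp (- \<mu> j * \<tau> j)) * Cst L \<mu> N \<alpha> (j + 1)) / \<mu> j"

definition rho_tilde ::
    "nat \<Rightarrow> (nat \<Rightarrow> real) \<Rightarrow> (nat \<Rightarrow> real) \<Rightarrow> (nat \<Rightarrow> real) \<Rightarrow> (nat \<Rightarrow> real) \<Rightarrow> nat \<Rightarrow> real \<Rightarrow> real" where
  "rho_tilde L \<mu> N \<tau> \<alpha> j s =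
     (if j = L then \<mu> L * N L * exp (- \<mu> L * s)
      else exp (- \<mu> j * s - Cst L \<mu> N \<alpha> (j + 1) / A_tilde L \<mu> N \<tau> \<alpha> j * max (s - \<tau> j) 0)
           * (\<mu> j * N j + Cst L \<mu> N \<alpha> (j + 1)))"

definition eligible :: "(nat \<Rightarrow> real) \<Rightarrow> (nat \<Rightarrow> real \<Rightarrow> real \<Rightarrow> real) \<Rightarrow> nat \<Rightarrow> real \<Rightarrow> real" where
  \<comment> \<open>The mass \<open>A\<^sub>j(t)\<close> of workers in job \<open>j\<close> who may be promoted.\<close>
  "eligible \<tau> \<rho> j t = (LINT s:{\<tau> j..}|lborel. \<rho> j t s)"

definition in_C_L1 :: "(real \<Rightarrow> real \<Rightarrow> real) \<Rightarrow> bool" where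
  \<comment> \<open>Membership in \<open>C([0,\<infinity>); L\<^sup>1([0,\<infinity>)))\<close>, for a jointly measurable representative.\<close>
  "in_C_L1 r \<longleftrightarrow>
     set_borel_measurable borel ({0..} \<times> {0..}) (\<lambda>(t, s). r t s) \<and>
     (\<forall>t\<ge>0. set_integrable lborel {0..} (r t)) \<and>
     (\<forall>t\<ge>0. ((\<lambda>u. LINT s:{0..}|lborel. \<bar>r u s - r t s\<bar>) \<longlongrightarrow> 0) (at t within {0..}))"

definition test_function ::
    "(real \<Rightarrow> real \<Rightarrow> real) \<Rightarrow> (real \<Rightarrow> real \<Rightarrow> real) \<Rightarrow> (real \<Rightarrow> real \<Rightarrow> real) \<Rightarrow> bool" where
  \<comment> \<open>\<open>\<phi>\<close> is \<open>C\<^sup>1\<close> with bounded support in the plane, and \<open>\<phi>t\<close>, \<open>\<phi>s\<close> are its partial derivatives.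
     It need not vanish on the axes \<open>t = 0\<close> and \<open>s = 0\<close>.\<close>
  "test_function \<phi> \<phi>t \<phi>s \<longleftrightarrow>
     (\<forall>t s. ((\<lambda>x. \<phi> x s) has_real_derivative \<phi>t t s) (at t)) \<and>
     (\<forall>t s. ((\<lambda>x. \<phi> t x) has_real_derivative \<phi>s t s) (at s)) \<and>
     continuous_on UNIV (\<lambda>(t, s). \<phi>t t s) \<and>
     continuous_on UNIV (\<lambda>(t, s). \<phi>s t s) \<and>
     bounded {(t, s). \<phi> t s \<noteq> 0}"

definition weak_transport ::
    "(real \<Rightarrow> real \<Rightarrow> real) \<Rightarrow> real \<Rightarrow> (real \<Rightarrow> real \<Rightarrow> real) \<Rightarrow> bool" where
  \<comment> \<open>Weak form of \<open>\<partial>\<^sub>t r + \<partial>\<^sub>s r + d r = 0\<close> on \<open>t, s > 0\<close> with inflow \<open>r(t, 0) = b\<close> and initial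
     value \<open>r 0\<close>: the equation is multiplied by \<open>\<phi>\<close> and integrated by parts in \<open>t\<close> and \<open>s\<close>.\<close>
  "weak_transport d b r \<longleftrightarrow>
     (\<forall>\<phi> \<phi>t \<phi>s. test_function \<phi> \<phi>t \<phi>s \<longrightarrow>
        (LINT t:{0..}|lborel. (LINT s:{0..}|lborel.
           r t s * (\<phi>t t s + \<phi>s t s - d t s * \<phi> t s)))
        + (LINT s:{0..}|lborel. r 0 s * \<phi> 0 s)
        + (LINT t:{0..}|lborel. b * \<phi> t 0) = 0)"

definition weak_solution ::
    "nat \<Rightarrow> (nat \<Rightarrow> real) \<Rightarrow> (nat \<Rightarrow> real) \<Rightarrow> (nat \<Rightarrow> real) \<Rightarrow> (nat \<Rightarrow> real) \<Rightarrow>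
     (nat \<Rightarrow> real \<Rightarrow> real \<Rightarrow> real) \<Rightarrow> bool" where
  "weak_solution L \<mu> N \<tau> \<alpha> \<rho> \<longleftrightarrow>
     (\<forall>j\<in>{1..L}. in_C_L1 (\<rho> j)) \<and>
     (\<forall>j\<in>{1..<L}. \<forall>t\<ge>0. eligible \<tau> \<rho> j t > 0) \<and>
     weak_transport (\<lambda>t s. \<mu> L) (\<mu> L * N L) (\<rho> L) \<and>
     (\<forall>j\<in>{1..<L}.
        weak_transport
          (\<lambda>t s. \<mu> j + Cst L \<mu> N \<alpha> (j + 1) / eligible \<tau> \<rho> j t * indicator {\<tau> j..} s)
          (\<mu> j * N j + Cst L \<mu> N \<alpha> (j + 1)) (\<rho> j))"

definition stationary_state ::
    "nat \<Rightarrow> (nat \<Rightarrow> real) \<Rightarrow> (nat \<Rightarrow> real) \<Rightarrow> (nat \<Rightarrow> real) \<Rightarrow> (nat \<Rightarrow> real) \<Rightarrow>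
     (nat \<Rightarrow> real \<Rightarrow> real) \<Rightarrow> bool" where
  "stationary_state L \<mu> N \<tau> \<alpha> \<sigma> \<longleftrightarrow>
     (\<forall>j\<in>{1..L}. AE s in lborel. 0 \<le> s \<longrightarrow> 0 \<le> \<sigma> j s) \<and>
     weak_solution L \<mu> N \<tau> \<alpha> (\<lambda>j t s. \<sigma> j s)"

end

(* Per level the equation is transport with loss rate mu + k(t) for seniorities s >= tau, where
   k(t) = K / A(t) depends on the solution only through the eligible mass A(t).  Testing the weak
   formulation with theta(t) exp(mu t) eta(s - t) turns it into an ordinary differential equation
   in t for the pairing of the density with eta(s - t).  The total mass relaxes to N like
   exp(-mu t), hence it equals N for stationary states and for the initial data considered.  For
   two solutions of mass N and t >= tau, the parts with s < tau come from the same inflow and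
   agree, so the eligible masses agree and the problem becomes linear: the difference of the two
   solutions is transported along characteristics and damped at least like exp(-mu t).  Applied to
   a stationary state and the explicit profile this gives uniqueness, and for a solution and the
   profile it gives the decay. *)

theory Submission
  imports Defs
begin

text \<open>The constants \<open>Cst L \<mu> N \<alpha> (j + 1)\<close> do not involve the solution,
  so the levels are decoupled and one level with a constant \<open>K\<close> can be studied alone;
  the top level is the case \<open>K = 0\<close>. A weak solution offers no formula along
  characteristics. Identities are therefore first proved for pairings with \<open>C1c\<close>
  functions and only then turned into almost-everywhere identities, by the fundamental lemma of the
  calculus of variations. The comparison of two solutions is linear only once their rates
  \<open>k\<close> coincide. Before time \<tau> the rates may differ, and no bound of the distance
  at time \<tau> by a fixed multiple of the initial distance is sought. The constant is instead
  built from the quotient of these two distances, which is legitimate because the datum determines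
  the solution; if the initial distance is 0, the solution is the profile itself.\<close>

section \<open>C^1 cutoff functions on the line\<close>

lemma DERIV_max_0_square:
  "((\<lambda>x::real. (max 0 x)\<^sup>2) has_real_derivative 2 * max 0 x) (at x)"
proof -
  consider "x > 0" | "x < 0" | "x = 0" by linarith
  then show ?thesis
  proof cases
    case 1
    have "((\<lambda>x::real. x\<^sup>2) has_real_derivative 2 * max 0 x) (at x)"
      using 1 by (auto intro!: derivative_eq_intros)
    then show ?thesis
      by (rule has_field_derivative_transform_within_open[where S="{0<..}"]) (use 1 in auto)
  next
    case 2
    have "((\<lambda>x::real. 0) has_real_derivative 2 * max 0 x) (at x)"
      using 2 by (auto intro!: derivative_eq_intros)
    then show ?thesis
      by (rule has_field_derivative_transform_within_open[where S="{..<0}"]) (use 2 in auto)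
  next
    case 3
    have "(\<lambda>h::real. max 0 h) \<midarrow>0\<rightarrow> max 0 0"
      by (intro tendsto_intros)
    moreover have "\<forall>\<^sub>F h in at (0::real). max 0 h = ((max 0 (0 + h))\<^sup>2 - (max 0 0)\<^sup>2) / h"
      by (auto simp: eventually_at_filter max_def power2_eq_square intro!: always_eventually)
    ultimately have "(\<lambda>h::real. ((max 0 (0 + h))\<^sup>2 - (max 0 0)\<^sup>2) / h) \<midarrow>0\<rightarrow> max 0 0"
      by (rule Lim_transform_eventually)
    then show ?thesis using 3 by (simp add: DERIV_def)
  qed
qed

text \<open>A C^1 step from 0 to 1 in closed form. Test functions need one continuous derivative
  only, so truncated squares suffice; the denominator is positive because \<open>x\<close> and
  \<open>1 - x\<close> are never both nonpositive.\<close>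

definition ramp :: "real \<Rightarrow> real" where
  "ramp x = (max 0 x)\<^sup>2 / ((max 0 x)\<^sup>2 + (max 0 (1 - x))\<^sup>2)"

definition ramp' :: "real \<Rightarrow> real" where
  "ramp' x = (2 * max 0 x * ((max 0 x)\<^sup>2 + (max 0 (1 - x))\<^sup>2)
     - (max 0 x)\<^sup>2 * (2 * max 0 x - 2 * max 0 (1 - x))) / ((max 0 x)\<^sup>2 + (max 0 (1 - x))\<^sup>2)\<^sup>2"

lemma ramp_denom_pos: "(max 0 x)\<^sup>2 + (max 0 (1 - x))\<^sup>2 > (0::real)"
proof (cases "x > 0")
  case True
  then show ?thesis by (intro add_pos_nonneg) auto
next
  case False
  then show ?thesis by (intro add_nonneg_pos) auto
qed

lemma ramp_eq_0: "x \<le> 0 \<Longrightarrow> ramp x = 0"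
  by (simp add: ramp_def)

lemma ramp_eq_1: "x \<ge> 1 \<Longrightarrow> ramp x = 1"
  by (simp add: ramp_def)

lemma ramp_bounds: "0 \<le> ramp x" "ramp x \<le> 1"
  using ramp_denom_pos[of x] by (auto simp: ramp_def divide_simps)

lemma DERIV_ramp: "(ramp has_real_derivative ramp' x) (at x)"
proof -
  have *: "((\<lambda>x::real. (max 0 (1 - x))\<^sup>2) has_real_derivative - (2 * max 0 (1 - x))) (at x)"
  proof -
    have "((\<lambda>x. 1 - x) has_real_derivative -1) (at x)"
      by (auto intro!: derivative_eq_intros)
    from DERIV_chain2[OF DERIV_max_0_square this] show ?thesis by simp
  qed
  have nz: "(max 0 x)\<^sup>2 + (max 0 (1 - x))\<^sup>2 \<noteq> 0"
    using less_imp_neq[OF ramp_denom_pos[of x]] by (rule not_sym)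
  from DERIV_divide[OF DERIV_max_0_square DERIV_add[OF DERIV_max_0_square *] nz]
  show ?thesis
    unfolding ramp_def[abs_def] ramp'_def by (simp add: power2_eq_square)
qed

lemma continuous_ramp': "continuous_on UNIV ramp'"
  unfolding ramp'_def[abs_def]
proof (intro continuous_intros ballI)
  show "((max 0 x)\<^sup>2 + (max 0 (1 - x))\<^sup>2)\<^sup>2 \<noteq> 0" for x :: real
    by (metis ramp_denom_pos less_irrefl power_not_zero)
qed

text \<open>One-variable counterpart of \<open>test_function\<close>. The derivative is an explicit
  argument there and here, so it can be inserted into the weak formulation directly.\<close>

definition C1c :: "(real \<Rightarrow> real) \<Rightarrow> (real \<Rightarrow> real) \<Rightarrow> bool" where
  "C1c f f' \<longleftrightarrow> (\<forall>x. (f has_real_derivative f' x) (at x)) \<and> continuous_on UNIV f'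
     \<and> bounded {x. f x \<noteq> 0}"

lemma C1c_DERIV: "C1c f f' \<Longrightarrow> (f has_real_derivative f' x) (at x)"
  by (simp add: C1c_def)

lemma C1c_continuous: assumes "C1c f f'" shows "continuous_on A f"
  using C1c_DERIV[OF assms] by (meson DERIV_isCont continuous_at_imp_continuous_on)

lemma C1c_continuous': "C1c f f' \<Longrightarrow> continuous_on A f'"
  unfolding C1c_def using continuous_on_subset by blast

lemma C1c_support:
  assumes "C1c f f'"
  obtains B where "B > 0" "\<And>x. \<bar>x\<bar> > B \<Longrightarrow> f x = 0" "\<And>x. \<bar>x\<bar> > B \<Longrightarrow> f' x = 0"
proof -
  obtain B where B: "B > 0" "\<And>x. f x \<noteq> 0 \<Longrightarrow> \<bar>x\<bar> \<le> B"
    using assms unfolding C1c_def bounded_pos by auto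
  have z: "f x = 0" if "\<bar>x\<bar> > B" for x
    using B(2)[of x] that by force
  have "f' x = 0" if "\<bar>x\<bar> > B" for x
  proof -
    \<comment> \<open>Only the support of \<open>f\<close> is known to be bounded; \<open>f'\<close>
      vanishes at \<open>x\<close> too because \<open>f\<close> is 0 on a neighbourhood of
      \<open>x\<close>.\<close>
    have "open {x. \<bar>x\<bar> > B}"
      by (intro open_Collect_less continuous_intros)
    moreover have "((\<lambda>x. 0) has_real_derivative 0) (at x)" by simp
    ultimately have "(f has_real_derivative 0) (at x)"
      using has_field_derivative_transform_within_open[of "\<lambda>x. 0" 0 x "{x. \<bar>x\<bar> > B}" f] z that
      by auto
    then show ?thesis
      using C1c_DERIV[OF assms] DERIV_unique by blast
  qed
  then show ?thesis using that B z by blast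
qed

lemma C1c_bounded:
  assumes "C1c f f'"
  obtains M where "M > 0" "\<And>x. \<bar>f x\<bar> \<le> M" "\<And>x. \<bar>f' x\<bar> \<le> M"
proof -
  obtain B where B: "B > 0" "\<And>x. \<bar>x\<bar> > B \<Longrightarrow> f x = 0" "\<And>x. \<bar>x\<bar> > B \<Longrightarrow> f' x = 0"
    using C1c_support[OF assms] by blast
  have "bounded (f ` {-B..B})" "bounded (f' ` {-B..B})"
    by (auto intro!: compact_imp_bounded compact_continuous_image
        C1c_continuous[OF assms] C1c_continuous'[OF assms])
  then obtain M M' where M: "\<And>x. x \<in> {-B..B} \<Longrightarrow> \<bar>f x\<bar> \<le> M" "\<And>x. x \<in> {-B..B} \<Longrightarrow> \<bar>f' x\<bar> \<le> M'"
    unfolding bounded_iff by (metis imageI real_norm_def)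
  have nonneg: "0 \<le> max M M'"
    using M(1)[of 0] B(1) by auto
  have "\<bar>f x\<bar> \<le> max M M' + 1 \<and> \<bar>f' x\<bar> \<le> max M M' + 1" for x
  proof (cases "\<bar>x\<bar> > B")
    case True then show ?thesis using B nonneg by simp
  next
    case False
    then have "x \<in> {-B..B}" by auto
    from M[OF this] show ?thesis by linarith
  qed
  then show ?thesis using that[of "max M M' + 1"] nonneg by auto
qed

lemma DERIV_ramp_affine:
  "((\<lambda>x. ramp (m * x + c)) has_real_derivative m * ramp' (m * x + c)) (at x)"
proof -
  have "((\<lambda>x. m * x + c) has_real_derivative m) (at x)"
    by (auto intro!: derivative_eq_intros)
  from DERIV_chain2[OF DERIV_ramp this] show ?thesis by (simp add: mult.commute)
qed

lemma continuous_ramp'_affine: "continuous_on UNIV (\<lambda>x. m * ramp' (m * x + c))"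
  by (intro continuous_intros continuous_on_compose2[OF continuous_ramp']) auto

text \<open>The slope grows with \<open>n\<close> while the support stays in \<open>{a..b}\<close>,
  so a constraint such as \<open>b \<le> c\<close> on the support of a test function holds along the
  whole approximating sequence.\<close>

definition plateau :: "nat \<Rightarrow> real \<Rightarrow> real \<Rightarrow> real \<Rightarrow> real" where
  "plateau n a b x = ramp (real n * (x - a)) * ramp (real n * (b - x))"

lemma plateau_bounds: "0 \<le> plateau n a b x" "plateau n a b x \<le> 1"
  using ramp_bounds by (auto simp: plateau_def intro!: mult_le_one)

lemma plateau_outside: "x \<le> a \<or> x \<ge> b \<Longrightarrow> plateau n a b x = 0"
  by (auto simp: plateau_def ramp_eq_0 mult_nonneg_nonpos)

lemma plateau_C1c: "\<exists>f'. C1c (plateau n a b) f'"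
proof -
  let ?m = "real n"
  have 1: "((\<lambda>x. ramp (?m * (x - a))) has_real_derivative ?m * ramp' (?m * x + - ?m * a)) (at x)" for x
    using DERIV_ramp_affine[of ?m "- ?m * a" x] by (simp add: right_diff_distrib)
  have 2: "((\<lambda>x. ramp (?m * (b - x))) has_real_derivative - ?m * ramp' (- ?m * x + ?m * b)) (at x)" for x
    using DERIV_ramp_affine[of "- ?m" "?m * b" x] by (simp add: right_diff_distrib)
  let ?f' = "\<lambda>x. (?m * ramp' (?m * x + - ?m * a)) * ramp (?m * (b - x)) +
    (- ?m * ramp' (- ?m * x + ?m * b)) * ramp (?m * (x - a))"
  have "C1c (plateau n a b) ?f'"
    unfolding C1c_def
  proof (intro conjI allI)
    show "(plateau n a b has_real_derivative ?f' x) (at x)" for x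
      unfolding plateau_def[abs_def] by (intro DERIV_mult 1 2)
    show "continuous_on UNIV ?f'"
      by (intro continuous_on_add continuous_on_mult[OF continuous_ramp'_affine]
        DERIV_continuous_on[OF has_field_derivative_at_within[OF 1]]
        DERIV_continuous_on[OF has_field_derivative_at_within[OF 2]])
    show "bounded {x. plateau n a b x \<noteq> 0}"
      by (rule bounded_subset[of "{a..b}"]) (auto, (metis plateau_outside nle_le)+)
  qed
  then show ?thesis by blast
qed

lemma plateau_tendsto: "(\<lambda>n. plateau n a b x) \<longlonglongrightarrow> indicator {a<..<b} x"
proof (cases "a < x \<and> x < b")
  case True
  obtain m where m: "1 / (x - a) < real m" "1 / (b - x) < real m"
    using reals_Archimedean2[of "max (1 / (x - a)) (1 / (b - x))"] by auto
  have "plateau n a b x = 1" if "n \<ge> m" for n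
  proof -
    have "1 / (x - a) \<le> real n" "1 / (b - x) \<le> real n"
      using m that by linarith+
    then have "real n * (x - a) \<ge> 1" "real n * (b - x) \<ge> 1"
      using True by (simp_all add: field_simps)
    then show ?thesis by (simp add: plateau_def ramp_eq_1)
  qed
  then have "\<forall>\<^sub>F n in sequentially. plateau n a b x = 1"
    by (rule eventually_sequentiallyI)
  then show ?thesis
    using True by (simp add: tendsto_eventually)
next
  case False
  then show ?thesis by (auto simp: plateau_outside not_less)
qed

section \<open>Fundamental lemma of the calculus of variations\<close>

text \<open>The positive and negative parts of \<open>g\<close> are densities of two finite
  measures. The hypothesis makes these agree on all rays, and rays determine such measures.\<close>

lemma AE_eq_0_if_interval_integrals_0:
  fixes g :: "real \<Rightarrow> real"
  assumes g: "integrable lborel g"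
    and z: "\<And>a b. (LINT x|lborel. indicator {a<..<b} x * g x) = 0"
  shows "AE x in lborel. g x = 0"
proof -
  have meas [measurable]: "g \<in> borel_measurable borel"
    using g by auto
  have half: "(LINT x|lborel. indicator {a<..} x * g x) = 0" for a
  proof -
    have "(\<lambda>n. LINT x|lborel. indicator {a<..<real n} x * g x)
        \<longlonglongrightarrow> (LINT x|lborel. indicator {a<..} x * g x)"
    proof (rule integral_dominated_convergence[where w="\<lambda>x. \<bar>g x\<bar>"])
      show "AE x in lborel. (\<lambda>n. indicator {a<..<real n} x * g x) \<longlonglongrightarrow> indicator {a<..} x * g x"
      proof (intro AE_I2 tendsto_mult tendsto_const)
        fix x :: real
        obtain m where m: "x < real m" using reals_Archimedean2 by blast
        have "indicator {a<..<real n} x = (indicator {a<..} x :: real)" if "n \<ge> m" for n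
          using m that by (auto simp: indicator_def)
        then have "\<forall>\<^sub>F n in sequentially. indicator {a<..<real n} x = (indicator {a<..} x :: real)"
          by (rule eventually_sequentiallyI)
        then show "(\<lambda>n. indicator {a<..<real n} x) \<longlonglongrightarrow> (indicator {a<..} x :: real)"
          by (rule tendsto_eventually)
      qed
      show "AE x in lborel. norm (indicator {a<..<real n} x * g x) \<le> \<bar>g x\<bar>" for n
        by (auto simp: indicator_def)
    qed (use g in auto)
    then show ?thesis by (simp add: z LIMSEQ_const_iff)
  qed
  \<comment> \<open>\<open>ennreal\<close> sends negative numbers to 0, so the densities of
    \<open>?M\<close> and \<open>?N\<close> are the positive and the negative part of
    \<open>g\<close>.\<close>
  let ?M = "density lborel (\<lambda>x. ennreal (g x))" and ?N = "density lborel (\<lambda>x. ennreal (- g x))"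
  have pos: "emeasure (density lborel (\<lambda>x. ennreal (h x))) {a<..}
      = ennreal (LINT x|lborel. indicator {a<..} x * max 0 (h x))"
    if h: "integrable lborel h" for h :: "real \<Rightarrow> real" and a
  proof -
    have hm: "h \<in> borel_measurable borel" using h by auto
    have "emeasure (density lborel (\<lambda>x. ennreal (h x))) {a<..}
        = (\<integral>\<^sup>+x. ennreal (h x) * indicator {a<..} x \<partial>lborel)"
      using hm by (subst emeasure_density) auto
    also have "\<dots> = (\<integral>\<^sup>+x. ennreal (indicator {a<..} x * max 0 (h x)) \<partial>lborel)"
      by (intro nn_integral_cong) (auto simp: indicator_def max_def ennreal_neg)
    also have "\<dots> = ennreal (LINT x|lborel. indicator {a<..} x * max 0 (h x))"
    proof (rule nn_integral_eq_integral)
      have "integrable lborel (\<lambda>x. max 0 (h x))" using h by auto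
      then show "integrable lborel (\<lambda>x. indicator {a<..} x * max 0 (h x))"
        by (rule Bochner_Integration.integrable_bound) (use hm in \<open>auto simp: indicator_def\<close>)
    qed auto
    finally show ?thesis .
  qed
  have "?M = ?N"
  proof (rule measure_eqI_lessThan)
    fix a
    have i: "integrable lborel (\<lambda>x. indicator {a<..} x * max 0 (h x))"
      if "integrable lborel h" for h :: "real \<Rightarrow> real"
    proof -
      have "integrable lborel (\<lambda>x. max 0 (h x))" using that by auto
      then show ?thesis
        by (rule Bochner_Integration.integrable_bound) (use that in \<open>auto simp: indicator_def\<close>)
    qed
    have "(LINT x|lborel. indicator {a<..} x * max 0 (g x))
        - (LINT x|lborel. indicator {a<..} x * max 0 (- g x))
        = (LINT x|lborel. indicator {a<..} x * max 0 (g x) - indicator {a<..} x * max 0 (- g x))"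
      using g by (intro Bochner_Integration.integral_diff[symmetric] i) auto
    also have "\<dots> = (LINT x|lborel. indicator {a<..} x * g x)"
      by (intro Bochner_Integration.integral_cong) (auto simp: max_def)
    finally show "emeasure ?M {a<..} = emeasure ?N {a<..}"
      using pos[of g a] pos[of "\<lambda>x. - g x" a] g half[of a] by simp
    show "emeasure ?M {a<..} < \<infinity>"
      using pos[OF g] by simp
  qed auto
  then have "AE x in lborel. ennreal (g x) = ennreal (- g x)"
    by (intro sigma_finite_measure.density_unique[OF lborel.sigma_finite_measure_axioms]) auto
  then show ?thesis
    by eventually_elim (metis ennreal_eq_0_iff ennreal_inj linear neg_0_le_iff_le neg_le_0_iff_le order_antisym_conv)
qed

lemma C1c_measurable:
  "C1c f f' \<Longrightarrow> f \<in> borel_measurable borel" "C1c f f' \<Longrightarrow> f' \<in> borel_measurable borel"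
  by (auto intro: borel_measurable_continuous_onI C1c_continuous C1c_continuous')

lemma integrable_mult_C1c:
  assumes "integrable lborel f" "C1c \<eta> \<eta>'"
  shows "integrable lborel (\<lambda>x. f x * \<eta> (x - T))" "integrable lborel (\<lambda>x. f x * \<eta>' (x - T))"
proof -
  obtain M where M: "M > 0" "\<And>x. \<bar>\<eta> x\<bar> \<le> M" "\<And>x. \<bar>\<eta>' x\<bar> \<le> M"
    using C1c_bounded[OF assms(2)] by blast
  have [measurable]: "\<eta> \<in> borel_measurable borel" "\<eta>' \<in> borel_measurable borel" "f \<in> borel_measurable borel"
    using assms C1c_measurable[OF assms(2)] by auto
  have i: "integrable lborel (\<lambda>x. M * \<bar>f x\<bar>)" using assms by auto
  have "\<bar>f x * \<eta> (x - T)\<bar> \<le> M * \<bar>f x\<bar>" "\<bar>f x * \<eta>' (x - T)\<bar> \<le> M * \<bar>f x\<bar>" for x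
    using mult_left_mono[OF M(2)[of "x - T"], of "\<bar>f x\<bar>"] mult_left_mono[OF M(3)[of "x - T"], of "\<bar>f x\<bar>"]
    by (auto simp: abs_mult mult.commute)
  then show "integrable lborel (\<lambda>x. f x * \<eta> (x - T))" "integrable lborel (\<lambda>x. f x * \<eta>' (x - T))"
    using M(1) by (auto intro!: Bochner_Integration.integrable_bound[OF i] AE_I2)
qed

text \<open>The one-sided form serves the seniorities below \<tau>, where only test functions
  vanishing from \<open>c\<close> on are available. Plateaus on an interval with
  \<open>b \<le> c\<close> are of this kind and converge boundedly to its indicator.\<close>

lemma AE_eq_0_if_test_integrals_0:
  fixes f :: "real \<Rightarrow> real"
  assumes f: "integrable lborel f"
    and z: "\<And>\<eta> \<eta>'. C1c \<eta> \<eta>' \<Longrightarrow> (\<And>x. x \<ge> c \<Longrightarrow> \<eta> x = 0) \<Longrightarrow> (LINT x|lborel. f x * \<eta> x) = 0"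
  shows "AE x in lborel. x < c \<longrightarrow> f x = 0"
proof -
  have meas [measurable]: "f \<in> borel_measurable borel"
    using f by auto
  have int: "(LINT x|lborel. f x * indicator {a<..<b} x) = 0" if "b \<le> c" for a b
  proof -
    have [measurable]: "plateau n a b \<in> borel_measurable borel" for n
      using plateau_C1c C1c_measurable by blast
    have "(\<lambda>n. LINT x|lborel. f x * plateau n a b x) \<longlonglongrightarrow> (LINT x|lborel. f x * indicator {a<..<b} x)"
    proof (rule integral_dominated_convergence[where w="\<lambda>x. \<bar>f x\<bar>"])
      show "AE x in lborel. (\<lambda>n. f x * plateau n a b x) \<longlonglongrightarrow> f x * indicator {a<..<b} x"
        by (intro AE_I2 tendsto_mult tendsto_const plateau_tendsto)
      show "AE x in lborel. norm (f x * plateau n a b x) \<le> \<bar>f x\<bar>" for n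
        using plateau_bounds by (auto simp: abs_mult mult_left_le)
    qed (use f in auto)
    moreover have "(LINT x|lborel. f x * plateau n a b x) = 0" for n
      using plateau_C1c[of n a b] that by (auto intro!: z plateau_outside)
    ultimately show ?thesis by (simp add: LIMSEQ_const_iff)
  qed
  have "AE x in lborel. indicator {..<c} x * f x = 0"
  proof (rule AE_eq_0_if_interval_integrals_0)
    show "integrable lborel (\<lambda>x. indicator {..<c} x * f x)"
      by (rule Bochner_Integration.integrable_bound[OF f]) (auto simp: indicator_def)
    fix a b
    \<comment> \<open>Truncation at \<open>c\<close> replaces the right end by
      \<open>min b c\<close>, which \<open>int\<close> covers.\<close>
    have "(LINT x|lborel. indicator {a<..<b} x * (indicator {..<c} x * f x))
        = (LINT x|lborel. f x * indicator {a<..<min b c} x)"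
      by (intro Bochner_Integration.integral_cong) (auto simp: indicator_def)
    then show "(LINT x|lborel. indicator {a<..<b} x * (indicator {..<c} x * f x)) = 0"
      by (simp add: int)
  qed
  then show ?thesis by eventually_elim auto
qed

section \<open>From a weak differential equation to its integrated form\<close>

text \<open>Bridge from the Lebesgue integrals of the weak formulation to gauge integrals over an
  interval, to which the fundamental theorem of calculus applies.\<close>

lemma LINT_half_line_eq_integral:
  fixes f :: "real \<Rightarrow> real"
  assumes "continuous_on {0..T} f" "\<And>t. t > T \<Longrightarrow> f t = 0"
  shows "(LINT t:{0..}|lborel. f t) = integral {0..T} f"
proof -
  have "(LINT t:{0..}|lborel. f t) = (LINT t:{0..T}|lborel. f t)"
    unfolding set_lebesgue_integral_def
    by (intro Bochner_Integration.integral_cong) (auto simp: indicator_def assms(2) not_le)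
  also have "\<dots> = integral {0..T} f"
    by (rule set_borel_integral_eq_integral(2)[OF borel_integrable_atLeastAtMost'[OF assms(1)]])
  finally show ?thesis .
qed

text \<open>The assumption \<open>weak\<close> is \<open>G' = h\<close> in the sense of
  distributions, tested up to the boundary point 0. Instead of mollifying, the defect
  \<open>H\<close> is tested against itself with a weight that cuts off at \<open>S\<close>;
  continuity turns a vanishing integral of \<open>(H t)\<^sup>2 * (S - t)\<close> into
  \<open>H T = 0\<close>.\<close>

lemma distributional_ODE:
  fixes G h :: "real \<Rightarrow> real"
  assumes G: "continuous_on {0..} G" and h: "continuous_on {0..} h"
    and weak: "\<And>\<theta> \<theta>'. C1c \<theta> \<theta>' \<Longrightarrow>
      (LINT t:{0..}|lborel. \<theta>' t * G t + \<theta> t * h t) + \<theta> 0 * G 0 = 0"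
    and T: "T \<ge> 0"
  shows "G T = G 0 + integral {0..T} h"
proof -
  define I where "I t = integral {0..t} h" for t
  define H where "H t = G t - G 0 - I t" for t
  \<comment> \<open>Strictly beyond \<open>T\<close>, so that the weight \<open>S - t\<close> is
    still positive at \<open>T\<close>.\<close>
  define S where "S = T + 1"
  have S: "S > 0" "T < S" using T by (auto simp: S_def)
  have contI: "continuous_on {0..b} I" for b
    unfolding I_def[abs_def]
    by (intro indefinite_integral_continuous_1 integrable_continuous_real continuous_on_subset[OF h]) auto
  have derI: "(I has_real_derivative h t) (at t)" if "0 < t" for t
  proof -
    have "(I has_real_derivative h t) (at t within {0..t+1})"
      unfolding I_def[abs_def] using that
      by (intro integral_has_real_derivative continuous_on_subset[OF h]) auto
    then show ?thesis
      using that by (subst (asm) at_within_interior) auto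
  qed
  have contH: "continuous_on {0..b} H" for b
    unfolding H_def[abs_def] by (intro continuous_intros contI continuous_on_subset[OF G]) auto
  \<comment> \<open>\<open>max 0 t\<close> extends \<open>H\<close> to negative times by its value
    at 0, which keeps \<open>f\<close> continuous on the line; the second factor makes
    \<open>f\<close> vanish from \<open>S\<close> on.\<close>
  define f where "f t = H (max 0 t) * max 0 (S - t)" for t
  have contf: "continuous_on {a..b} f" for a b
    unfolding f_def[abs_def]
    by (intro continuous_intros continuous_on_compose2[OF contH[of "max 0 b"]]) auto
  text \<open>The test function is an antiderivative of \<open>f\<close> that vanishes for \<open>t \<ge> S\<close>, cut off at negative times.\<close>
  define F where "F t = integral {-3..t} f - integral {-3..S} f" for t
  have F0: "F t = 0" if "t \<ge> S" for t
  proof -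
    have "integral {-3..t} f = integral {-3..S} f + integral {S..t} f"
      using that S by (intro Henstock_Kurzweil_Integration.integral_combine[symmetric]
          integrable_continuous_real contf) auto
    moreover have "integral {S..t} f = integral {S..t} (\<lambda>x. 0)"
      by (intro Henstock_Kurzweil_Integration.integral_cong) (auto simp: f_def)
    ultimately show ?thesis by (simp add: F_def)
  qed
  have derF: "(F has_real_derivative f t) (at t)" if "-3 < t" for t
  proof -
    have "(F has_real_derivative f t - 0) (at t within {-3..t+1})"
      unfolding F_def[abs_def] using that
      by (intro DERIV_diff DERIV_const integral_has_real_derivative contf) auto
    then show ?thesis
      using that by (subst (asm) at_within_interior) auto
  qed
  \<comment> \<open>Differentiability of \<open>F\<close> is available only to the right of -3. The
    cutoff is 0 up to -2 and 1 from -1 on, so \<open>\<theta>\<close> is C^1 on the line and equals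
    \<open>F\<close> for \<open>t \<ge> 0\<close>.\<close>
  define \<theta> where "\<theta> t = ramp (1 * t + 2) * F t" for t
  define \<theta>' where "\<theta>' t = 1 * ramp' (1 * t + 2) * F t + f t * ramp (1 * t + 2)" for t
  have r0: "ramp (t + 2) = 0" "ramp' (t + 2) = 0" if "t \<le> -2" for t
    using that by (auto simp: ramp_def ramp'_def)
  have der: "(\<theta> has_real_derivative \<theta>' t) (at t)" for t
  proof (cases "t > -3")
    case True
    then show ?thesis
      unfolding \<theta>_def[abs_def] \<theta>'_def by (intro DERIV_mult DERIV_ramp_affine derF)
  next
    case False
    have "((\<lambda>x. 0) has_real_derivative 0) (at t)" by simp
    then have "(\<theta> has_real_derivative 0) (at t)"
      by (rule has_field_derivative_transform_within_open[where S="{..<-2}"])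
         (use False in \<open>auto simp: \<theta>_def r0\<close>)
    then show ?thesis using False by (simp add: \<theta>'_def r0)
  qed
  have cont\<theta>': "continuous_on UNIV \<theta>'"
  proof (rule continuous_at_imp_continuous_on, rule ballI)
    fix t :: real
    show "isCont \<theta>' t"
    proof (cases "t > -3")
      case True
      have "isCont f t"
        using continuous_on_interior[OF contf, of t "t-1" "t+1"] by auto
      moreover have "isCont ramp' x" for x
        using continuous_ramp' by (simp add: continuous_on_eq_continuous_at)
      ultimately show ?thesis
        unfolding \<theta>'_def[abs_def]
        by (intro continuous_intros isCont_o2[where g=ramp' and f="\<lambda>t. 1 * t + 2"]
            DERIV_isCont[OF derF] DERIV_isCont[OF DERIV_ramp_affine] True)
    next
      case False
      have "\<forall>\<^sub>F x in nhds t. \<theta>' x = 0"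
        using eventually_nhds_in_open[of "{..<-2}" t] False
        by (auto elim!: eventually_mono simp: \<theta>'_def r0)
      then show ?thesis by (simp add: isCont_cong)
    qed
  qed
  have supp: "bounded {t. \<theta> t \<noteq> 0}"
    by (rule bounded_subset[of "{-2..S}"]) (auto simp: \<theta>_def, (metis F0 r0 nle_le)+)
  have test: "C1c \<theta> \<theta>'"
    using der cont\<theta>' supp by (simp add: C1c_def)
  have pos: "\<theta> t = F t" "\<theta>' t = f t" if "t \<ge> 0" for t
  proof -
    show "\<theta> t = F t" using that by (simp add: \<theta>_def ramp_eq_1)
    show "\<theta>' t = f t" using that by (simp add: \<theta>'_def ramp_eq_1 ramp'_def)
  qed
  have contF: "continuous_on {0..S} F"
    by (rule DERIV_continuous_on[where D=f], rule has_field_derivative_at_within, rule derF) simp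
  have "(LINT t:{0..}|lborel. \<theta>' t * G t + \<theta> t * h t) = integral {0..S} (\<lambda>t. \<theta>' t * G t + \<theta> t * h t)"
  proof (rule LINT_half_line_eq_integral[where T=S and f="\<lambda>t. \<theta>' t * G t + \<theta> t * h t"])
    have "continuous_on {0..S} G" "continuous_on {0..S} h"
      using G h by (auto elim: continuous_on_subset)
    then show "continuous_on {0..S} (\<lambda>t. \<theta>' t * G t + \<theta> t * h t)"
      by (intro continuous_on_add continuous_on_mult C1c_continuous[OF test] C1c_continuous'[OF test])
    show "\<theta>' t * G t + \<theta> t * h t = 0" if "S < t" for t
      using that S pos[of t] F0[of t] by (simp add: f_def)
  qed
  also have "\<dots> = integral {0..S} (\<lambda>t. f t * G t + F t * h t)"
    by (intro Henstock_Kurzweil_Integration.integral_cong) (simp add: pos)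
  finally have eq1: "integral {0..S} (\<lambda>t. f t * G t + F t * h t) + F 0 * G 0 = 0"
    using weak[OF test] pos[of 0] by simp
  \<comment> \<open>By the product rule \<open>G 0 + I t\<close> satisfies the same identity as
    \<open>G\<close>, the boundary term at \<open>S\<close> being 0. The difference of the two
    identities contains only \<open>f t * H t\<close>.\<close>
  have "((\<lambda>t. f t * (G 0 + I t) + h t * F t) has_integral F S * (G 0 + I S) - F 0 * (G 0 + I 0)) {0..S}"
  proof (rule fundamental_theorem_of_calculus_interior)
    show "continuous_on {0..S} (\<lambda>t. F t * (G 0 + I t))"
      by (intro continuous_intros contF contI)
    show "((\<lambda>t. F t * (G 0 + I t)) has_vector_derivative f t * (G 0 + I t) + h t * F t) (at t)"
      if "t \<in> {0<..<S}" for t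
    proof -
      have "((\<lambda>t. G 0 + I t) has_real_derivative 0 + h t) (at t)"
        using that by (intro DERIV_add DERIV_const derI) auto
      then show ?thesis
        unfolding has_real_derivative_iff_has_vector_derivative[symmetric]
        using that by (intro DERIV_mult derF) auto
    qed
  qed (use S in auto)
  then have eq2: "integral {0..S} (\<lambda>t. f t * (G 0 + I t) + h t * F t) = - F 0 * G 0"
    by (simp add: integral_unique F0 I_def)
  have "integral {0..S} (\<lambda>t. f t * H t)
      = integral {0..S} (\<lambda>t. (f t * G t + F t * h t) - (f t * (G 0 + I t) + h t * F t))"
    by (intro Henstock_Kurzweil_Integration.integral_cong) (simp add: H_def algebra_simps)
  also have "\<dots> = 0"
    using eq1 eq2
    by (subst Henstock_Kurzweil_Integration.integral_diff)
       (auto intro!: integrable_continuous_real continuous_intros contf contF contI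
         continuous_on_subset[OF G] continuous_on_subset[OF h])
  finally have "integral {0..S} (\<lambda>t. f t * H t) = 0" .
  moreover have "(\<lambda>t. f t * H t) integrable_on {0..S}"
    by (intro integrable_continuous_real continuous_intros contf contH)
  ultimately have int0: "((\<lambda>t. f t * H t) has_integral 0) (cbox 0 S)"
    by (metis box_real(2) integrable_integral)
  have "f T * H T = 0"
  proof (rule has_integral_0_cbox_imp_0[OF _ _ int0])
    show "continuous_on (cbox 0 S) (\<lambda>t. f t * H t)"
      unfolding box_real by (intro continuous_intros contf contH)
    show "0 \<le> f x * H x" if "x \<in> box 0 S" for x
    proof -
      have "f x * H x = (H x)\<^sup>2 * (S - x)"
        using that by (simp add: f_def power2_eq_square)
      moreover have "\<dots> \<ge> 0" using that by (intro mult_nonneg_nonneg) auto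
      ultimately show ?thesis by linarith
    qed
    show "box 0 S \<noteq> {}" using S by simp
    show "T \<in> cbox 0 S" using T S by auto
  qed
  then have "H T = 0"
    using T S by (auto simp: f_def)
  then show ?thesis by (simp add: H_def I_def)
qed

section \<open>A single job level: loss rate, pairings and total mass\<close>

text \<open>\<open>K\<close> stands for \<open>Cst L \<mu> N \<alpha> (j + 1)\<close>. The
  alternative \<open>K = 0\<close> admits the top level, whose eligible mass is not assumed
  positive; the promotion rate is then 0 even if its denominator is 0.\<close>

locale job_level =
  fixes \<mu> N K \<tau> :: real and r :: "real \<Rightarrow> real \<Rightarrow> real"
  assumes mu_pos: "\<mu> > 0" and K_nonneg: "K \<ge> 0" and tau_nonneg: "\<tau> \<ge> 0"
    and r_C_L1: "in_C_L1 r"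
    and A_pos: "\<And>t. t \<ge> 0 \<Longrightarrow> K = 0 \<or> (LINT s:{\<tau>..}|lborel. r t s) > 0"
    and r_weak: "weak_transport (\<lambda>t s. \<mu> + K / (LINT s:{\<tau>..}|lborel. r t s) * indicator {\<tau>..} s) (\<mu> * N + K) r"
begin

text \<open>Extension by 0 to negative seniorities: half-line integrals become integrals over the
  whole line, where translation along characteristics preserves them.\<close>

definition R :: "real \<Rightarrow> real \<Rightarrow> real" where "R t s = indicator {0..} s * r t s"

definition A :: "real \<Rightarrow> real" where "A t = (LINT s|lborel. R t s * indicator {\<tau>..} s)"

definition mass :: "real \<Rightarrow> real" where "mass t = (LINT s|lborel. R t s)"

definition k :: "real \<Rightarrow> real" where "k t = K / A t"

lemma R_integrable: "t \<ge> 0 \<Longrightarrow> integrable lborel (R t)"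
  using r_C_L1 unfolding in_C_L1_def set_integrable_def R_def[abs_def] by simp

lemma A_eq: "(LINT s:{\<tau>..}|lborel. r t s) = A t"
  unfolding set_lebesgue_integral_def A_def R_def
  using tau_nonneg by (intro Bochner_Integration.integral_cong) (auto simp: indicator_def)

lemma k_nonneg: "t \<ge> 0 \<Longrightarrow> k t \<ge> 0"
  using A_pos[of t] K_nonneg by (auto simp: k_def A_eq)

lemma k_times_A: "t \<ge> 0 \<Longrightarrow> k t * A t = K"
  using A_pos[of t] by (auto simp: k_def A_eq)

lemma R_L1_tendsto:
  assumes "t \<ge> 0"
  shows "((\<lambda>u. LINT s|lborel. \<bar>R u s - R t s\<bar>) \<longlongrightarrow> 0) (at t within {0..})"
proof -
  have "(LINT s:{0..}|lborel. \<bar>r u s - r t s\<bar>) = (LINT s|lborel. \<bar>R u s - R t s\<bar>)" for u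
    unfolding set_lebesgue_integral_def R_def
    by (intro Bochner_Integration.integral_cong) (auto simp: indicator_def)
  moreover have "((\<lambda>u. LINT s:{0..}|lborel. \<bar>r u s - r t s\<bar>) \<longlongrightarrow> 0) (at t within {0..})"
    using r_C_L1 assms by (simp add: in_C_L1_def)
  ultimately show ?thesis by simp
qed

lemma pairing_integrable:
  assumes "t \<ge> 0" and [measurable]: "w \<in> borel_measurable borel" and "\<And>s. \<bar>w s\<bar> \<le> M"
  shows "integrable lborel (\<lambda>s. R t s * w s)"
proof -
  note [measurable] = borel_measurable_integrable[OF R_integrable[OF assms(1)]]
  have i: "integrable lborel (\<lambda>s. M * \<bar>R t s\<bar>)" using R_integrable[OF assms(1)] by auto
  have b: "\<bar>R t s * w s\<bar> \<le> \<bar>M * \<bar>R t s\<bar>\<bar>" for s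
    using mult_left_mono[OF assms(3)[of s], of "\<bar>R t s\<bar>"] assms(3)[of s]
    by (auto simp: abs_mult mult.commute)
  show ?thesis
    by (rule Bochner_Integration.integrable_bound[OF i]) (simp_all add: b)
qed

text \<open>The weight has to be Lipschitz in time, uniformly in \<open>s\<close>, but may jump in
  \<open>s\<close>. This admits \<open>indicator {\<tau>..}\<close>, which enters the eligible
  mass.\<close>

lemma pairing_continuous:
  assumes meas: "\<And>t. w t \<in> borel_measurable borel"
    and M: "\<And>t s. \<bar>w t s\<bar> \<le> M"
    and Lip: "\<And>u t s. \<bar>w u s - w t s\<bar> \<le> \<Lambda> * \<bar>u - t\<bar>"
  shows "continuous_on {0..} (\<lambda>t. LINT s|lborel. R t s * w t s)"
  unfolding continuous_on_def
proof
  fix t :: real assume "t \<in> {0..}"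
  then have t: "t \<ge> 0" by simp
  let ?g = "\<lambda>u. M * (LINT s|lborel. \<bar>R u s - R t s\<bar>) + \<Lambda> * \<bar>u - t\<bar> * (LINT s|lborel. \<bar>R t s\<bar>)"
  have "((\<lambda>u. \<bar>u - t\<bar>) \<longlongrightarrow> \<bar>t - t\<bar>) (at t within {0..})"
    by (intro tendsto_intros)
  then have g: "(?g \<longlongrightarrow> M * 0 + \<Lambda> * \<bar>t - t\<bar> * (LINT s|lborel. \<bar>R t s\<bar>)) (at t within {0..})"
    by (intro tendsto_add tendsto_mult tendsto_const R_L1_tendsto t)
  have "\<bar>(LINT s|lborel. R u s * w u s) - (LINT s|lborel. R t s * w t s)\<bar> \<le> ?g u" if u: "u \<ge> 0" for u
  proof -
    note i = pairing_integrable[OF _ meas M]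
    have iD: "integrable lborel (\<lambda>s. \<bar>R u s - R t s\<bar>)"
      using R_integrable[OF u] R_integrable[OF t] by auto
    have eq: "(LINT s|lborel. R u s * w u s) - (LINT s|lborel. R t s * w t s)
        = (LINT s|lborel. R u s * w u s - R t s * w t s)"
      by (intro Bochner_Integration.integral_diff[symmetric] i u t)
    have "\<bar>(LINT s|lborel. R u s * w u s) - (LINT s|lborel. R t s * w t s)\<bar>
        \<le> (LINT s|lborel. \<bar>R u s * w u s - R t s * w t s\<bar>)"
      unfolding eq by (rule integral_abs_bound)
    also have "\<dots> \<le> (LINT s|lborel. M * \<bar>R u s - R t s\<bar> + \<Lambda> * \<bar>u - t\<bar> * \<bar>R t s\<bar>)"
    proof (rule integral_mono)
      show "integrable lborel (\<lambda>s. \<bar>R u s * w u s - R t s * w t s\<bar>)"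
        by (intro integrable_abs Bochner_Integration.integrable_diff i u t)
      show "integrable lborel (\<lambda>s. M * \<bar>R u s - R t s\<bar> + \<Lambda> * \<bar>u - t\<bar> * \<bar>R t s\<bar>)"
        using iD R_integrable[OF t] by auto
      fix s
      \<comment> \<open>The first summand is controlled by the continuity of \<open>R\<close> in
        L^1, the second by the Lipschitz bound on \<open>w\<close>.\<close>
      have eq: "R u s * w u s - R t s * w t s = (R u s - R t s) * w u s + R t s * (w u s - w t s)"
        by (simp add: algebra_simps)
      have "\<bar>R u s * w u s - R t s * w t s\<bar> \<le> \<bar>R u s - R t s\<bar> * \<bar>w u s\<bar> + \<bar>R t s\<bar> * \<bar>w u s - w t s\<bar>"
        unfolding eq by (simp add: abs_mult[symmetric])
      also have "\<dots> \<le> \<bar>R u s - R t s\<bar> * M + \<bar>R t s\<bar> * (\<Lambda> * \<bar>u - t\<bar>)"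
        by (intro add_mono mult_left_mono M Lip) auto
      finally show "\<bar>R u s * w u s - R t s * w t s\<bar> \<le> M * \<bar>R u s - R t s\<bar> + \<Lambda> * \<bar>u - t\<bar> * \<bar>R t s\<bar>"
        by (simp add: mult_ac)
    qed
    also have "\<dots> = ?g u"
      using iD R_integrable[OF t] by (subst Bochner_Integration.integral_add) auto
    finally show ?thesis .
  qed
  then have "\<forall>\<^sub>F u in at t within {0..}.
      norm ((LINT s|lborel. R u s * w u s) - (LINT s|lborel. R t s * w t s)) \<le> ?g u"
    by (auto simp: eventually_at_filter)
  from Lim_null_comparison[OF this] g
  have "((\<lambda>u. (LINT s|lborel. R u s * w u s) - (LINT s|lborel. R t s * w t s)) \<longlongrightarrow> 0) (at t within {0..})"
    by simp
  then show "((\<lambda>t. LINT s|lborel. R t s * w t s) \<longlongrightarrow> (LINT s|lborel. R t s * w t s)) (at t within {0..})"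
    by (rule Lim_null[THEN iffD2])
qed

lemma A_continuous: "continuous_on {0..} A"
proof -
  have "continuous_on {0..} (\<lambda>t. LINT s|lborel. R t s * indicator {\<tau>..} s)"
  proof (rule pairing_continuous[where M=1 and \<Lambda>=0 and w="\<lambda>t s. indicator {\<tau>..} s"])
    show "\<bar>indicator {\<tau>..} s\<bar> \<le> (1::real)" for s
      by (simp add: indicator_def)
  qed simp_all
  then show ?thesis by (simp add: A_def[abs_def])
qed

lemma k_continuous: "continuous_on {0..} k"
proof (cases "K = 0")
  case True
  have "k = (\<lambda>t. 0)" unfolding k_def[abs_def] using True by simp
  then show ?thesis by simp
next
  case False
  have "\<forall>t\<in>{0..}. A t \<noteq> 0"
    using A_pos False by (force simp: A_eq)
  then show ?thesis
    unfolding k_def[abs_def] by (rule continuous_on_divide[OF continuous_on_const A_continuous])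
qed

text \<open>Weights that are functions of \<open>s - t\<close> are constant along the characteristics, so only the inflow
  and the promotion term \<open>k t * Q \<eta> t\<close> contribute to the evolution of \<open>P \<eta>\<close>.\<close>

definition P :: "(real \<Rightarrow> real) \<Rightarrow> real \<Rightarrow> real" where
  "P \<eta> t = (LINT s|lborel. R t s * \<eta> (s - t))"

definition Q :: "(real \<Rightarrow> real) \<Rightarrow> real \<Rightarrow> real" where
  "Q \<eta> t = (LINT s|lborel. R t s * (indicator {\<tau>..} s * \<eta> (s - t)))"

lemma PQ_continuous:
  assumes "C1c \<eta> \<eta>'"
  shows "continuous_on {0..} (P \<eta>)" "continuous_on {0..} (Q \<eta>)"
proof -
  obtain M where M: "M > 0" "\<And>x. \<bar>\<eta> x\<bar> \<le> M" "\<And>x. \<bar>\<eta>' x\<bar> \<le> M"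
    using C1c_bounded[OF assms] by blast
  have Lip: "\<bar>\<eta> x - \<eta> y\<bar> \<le> M * \<bar>x - y\<bar>" for x y
  proof -
    have "norm (\<eta> x - \<eta> y) \<le> M * norm (x - y)"
      by (rule field_differentiable_bound[of UNIV \<eta> \<eta>'])
         (use C1c_DERIV[OF assms] M(3) in auto)
    then show ?thesis by simp
  qed
  note [measurable] = C1c_measurable(1)[OF assms]
  have Lip': "\<bar>\<eta> (s - u) - \<eta> (s - t)\<bar> \<le> M * \<bar>u - t\<bar>" for u s t
    using Lip[of "s - u" "s - t"] abs_minus_commute[of u t] by simp
  have 0: "0 \<le> M * \<bar>u - t\<bar>" for u t using M(1) by simp
  show "continuous_on {0..} (P \<eta>)" unfolding P_def[abs_def]
    by (rule pairing_continuous[where M=M and \<Lambda>=M and w="\<lambda>t s. \<eta> (s - t)"]) (simp_all add: M(2) Lip')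
  show "continuous_on {0..} (Q \<eta>)" unfolding Q_def[abs_def]
  proof (rule pairing_continuous[where M=M and \<Lambda>=M and w="\<lambda>t s. indicator {\<tau>..} s * \<eta> (s - t)"])
    show "\<bar>indicator {\<tau>..} s * \<eta> (s - t)\<bar> \<le> M" for t s
      using M by (cases "s \<ge> \<tau>") (simp_all add: less_imp_le)
    show "\<bar>indicator {\<tau>..} s * \<eta> (s - u) - indicator {\<tau>..} s * \<eta> (s - t)\<bar> \<le> M * \<bar>u - t\<bar>" for u t s
      using Lip' 0 by (cases "s \<ge> \<tau>") simp_all
  qed simp_all
qed

lemma PQ_integrable:
  assumes "C1c \<eta> \<eta>'" "t \<ge> 0"
  shows "integrable lborel (\<lambda>s. R t s * \<eta> (s - t))"
    "integrable lborel (\<lambda>s. R t s * (indicator {\<tau>..} s * \<eta> (s - t)))"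
proof -
  obtain M where M: "M > 0" "\<And>x. \<bar>\<eta> x\<bar> \<le> M" "\<And>x. \<bar>\<eta>' x\<bar> \<le> M"
    using C1c_bounded[OF assms(1)] by blast
  note [measurable] = C1c_measurable(1)[OF assms(1)]
  show "integrable lborel (\<lambda>s. R t s * \<eta> (s - t))"
    by (rule pairing_integrable[OF assms(2), where M=M]) (simp_all add: M(2))
  show "integrable lborel (\<lambda>s. R t s * (indicator {\<tau>..} s * \<eta> (s - t)))"
  proof (rule pairing_integrable[OF assms(2), where M=M])
    show "\<bar>indicator {\<tau>..} s * \<eta> (s - t)\<bar> \<le> M" for s
      using M by (cases "s \<ge> \<tau>") (simp_all add: less_imp_le)
  qed simp_all
qed

end

text \<open>In the sum of the two partial derivatives the terms with \<open>\<eta>'\<close> cancel,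
  and the derivative of \<open>exp (\<mu> * t)\<close> cancels the turnover term. Only the term with
  \<open>\<theta>'\<close> and the promotion term remain in the weak formulation.\<close>

lemma test_function_transported:
  assumes \<theta>: "C1c \<theta> \<theta>'" and \<eta>: "C1c \<eta> \<eta>'"
  shows "test_function (\<lambda>t s. \<theta> t * exp (\<mu> * t) * \<eta> (s - t))
    (\<lambda>t s. (\<theta>' t * exp (\<mu> * t) + \<mu> * exp (\<mu> * t) * \<theta> t) * \<eta> (s - t) + - \<eta>' (s - t) * (\<theta> t * exp (\<mu> * t)))
    (\<lambda>t s. \<theta> t * exp (\<mu> * t) * \<eta>' (s - t))"
  unfolding test_function_def
proof (intro conjI allI)
  fix t s
  have "((\<lambda>x. exp (\<mu> * x)) has_real_derivative \<mu> * exp (\<mu> * t)) (at t)"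
    by (rule DERIV_cong[OF DERIV_chain2[OF DERIV_exp DERIV_cmult_Id]]) simp
  moreover have "((\<lambda>x. s - x) has_real_derivative - 1) (at t)"
    by (auto intro!: derivative_eq_intros)
  from DERIV_chain2[OF C1c_DERIV[OF \<eta>] this]
  have "((\<lambda>x. \<eta> (s - x)) has_real_derivative - \<eta>' (s - t)) (at t)" by simp
  ultimately show "((\<lambda>x. \<theta> x * exp (\<mu> * x) * \<eta> (s - x)) has_real_derivative
     (\<theta>' t * exp (\<mu> * t) + \<mu> * exp (\<mu> * t) * \<theta> t) * \<eta> (s - t) + - \<eta>' (s - t) * (\<theta> t * exp (\<mu> * t))) (at t)"
    by (intro DERIV_mult C1c_DERIV[OF \<theta>])
  have "((\<lambda>x. x - t) has_real_derivative 1) (at s)"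
    by (auto intro!: derivative_eq_intros)
  from DERIV_chain2[OF C1c_DERIV[OF \<eta>] this]
  have "((\<lambda>x. \<eta> (x - t)) has_real_derivative \<eta>' (s - t)) (at s)" by simp
  then show "((\<lambda>x. \<theta> t * exp (\<mu> * t) * \<eta> (x - t)) has_real_derivative \<theta> t * exp (\<mu> * t) * \<eta>' (s - t)) (at s)"
    by (rule DERIV_cmult)
next
  have c: "continuous_on UNIV (\<lambda>z::real\<times>real. f (fst z))" "continuous_on UNIV (\<lambda>z::real\<times>real. f (snd z - fst z))"
    if "continuous_on UNIV f" for f :: "real \<Rightarrow> real"
    by (auto intro!: continuous_on_compose2[OF that] continuous_intros)
  show "continuous_on UNIV (\<lambda>(t, s). (\<theta>' t * exp (\<mu> * t) + \<mu> * exp (\<mu> * t) * \<theta> t) * \<eta> (s - t) + - \<eta>' (s - t) * (\<theta> t * exp (\<mu> * t)))"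
    unfolding case_prod_beta
    by (intro continuous_on_add continuous_on_mult continuous_on_minus continuous_on_exp continuous_on_const continuous_on_fst continuous_on_id
       c C1c_continuous[OF \<theta>] C1c_continuous[OF \<eta>] C1c_continuous'[OF \<theta>] C1c_continuous'[OF \<eta>])
  show "continuous_on UNIV (\<lambda>(t, s). \<theta> t * exp (\<mu> * t) * \<eta>' (s - t))"
    unfolding case_prod_beta
    by (intro continuous_on_add continuous_on_mult continuous_on_minus continuous_on_exp continuous_on_const continuous_on_fst continuous_on_id
       c C1c_continuous[OF \<theta>] C1c_continuous[OF \<eta>] C1c_continuous'[OF \<theta>] C1c_continuous'[OF \<eta>])
  obtain a where "a > 0" and a: "\<And>x. \<bar>x\<bar> > a \<Longrightarrow> \<theta> x = 0" "\<And>x. \<bar>x\<bar> > a \<Longrightarrow> \<theta>' x = 0"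
    using C1c_support[OF \<theta>] by blast
  obtain c where "c > 0" and c: "\<And>x. \<bar>x\<bar> > c \<Longrightarrow> \<eta> x = 0" "\<And>x. \<bar>x\<bar> > c \<Longrightarrow> \<eta>' x = 0"
    using C1c_support[OF \<eta>] by blast
  \<comment> \<open>\<open>\<eta> (s - t)\<close> alone is supported in an unbounded strip;
    \<open>\<theta>\<close> confines \<open>t\<close>, and then \<open>s\<close> is confined as
    well.\<close>
  have "{(t, s). \<theta> t * exp (\<mu> * t) * \<eta> (s - t) \<noteq> 0} \<subseteq> {-a..a} \<times> {-a-c..a+c}"
  proof clarsimp
    fix t s assume "\<theta> t \<noteq> 0" "\<eta> (s - t) \<noteq> 0"
    then have "\<bar>t\<bar> \<le> a" "\<bar>s - t\<bar> \<le> c" using a(1)[of t] c(1)[of "s - t"] by (auto simp: not_less[symmetric])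
    then show "- a \<le> t \<and> t \<le> a \<and> - a - c \<le> s \<and> s \<le> a + c" by auto
  qed
  then show "bounded {(t, s). \<theta> t * exp (\<mu> * t) * \<eta> (s - t) \<noteq> 0}"
    by (rule bounded_subset[rotated]) (intro bounded_Times; simp)
qed

context job_level
begin

text \<open>The weak formulation becomes a distributional equation in time for
  \<open>exp (\<mu> * t) * P \<eta> t\<close>: in the proof, \<open>?h1\<close> is the promotion
  loss and \<open>?h2\<close> the inflow at seniority 0, where the weight is
  \<open>\<eta> (- t)\<close>.\<close>

lemma P_evolution:
  assumes \<eta>: "C1c \<eta> \<eta>'" and T: "T \<ge> 0"
  shows "exp (\<mu> * T) * P \<eta> T
    = P \<eta> 0 + integral {0..T} (\<lambda>t. exp (\<mu> * t) * ((\<mu> * N + K) * \<eta> (- t) - k t * Q \<eta> t))"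
proof -
  let ?G = "\<lambda>t. exp (\<mu> * t) * P \<eta> t"
  let ?h1 = "\<lambda>t. - (exp (\<mu> * t) * k t * Q \<eta> t)" and ?h2 = "\<lambda>t. (\<mu> * N + K) * exp (\<mu> * t) * \<eta> (- t)"
  have ce: "continuous_on S (\<lambda>t. exp (\<mu> * t))" for S by (intro continuous_intros)
  have cn: "continuous_on S (\<lambda>t. \<eta> (- t))" for S
    by (rule continuous_on_compose2[OF C1c_continuous[OF \<eta>, of UNIV]]) (auto intro: continuous_intros)
  have cG: "continuous_on {0..} ?G"
    by (rule continuous_on_mult[OF ce PQ_continuous(1)[OF \<eta>]])
  have c1: "continuous_on {0..} ?h1"
    by (rule continuous_on_minus[OF continuous_on_mult[OF continuous_on_mult[OF ce k_continuous] PQ_continuous(2)[OF \<eta>]]])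
  have c2: "continuous_on {0..} ?h2"
    by (rule continuous_on_mult[OF continuous_on_mult[OF continuous_on_const ce] cn])
  have main: "?G T = ?G 0 + integral {0..T} (\<lambda>t. ?h1 t + ?h2 t)"
  proof (rule distributional_ODE[OF cG continuous_on_add[OF c1 c2] _ T])
    fix \<theta> \<theta>' assume \<theta>: "C1c \<theta> \<theta>'"
    obtain B where B: "B > 0" "\<And>x. \<bar>x\<bar> > B \<Longrightarrow> \<theta> x = 0" "\<And>x. \<bar>x\<bar> > B \<Longrightarrow> \<theta>' x = 0"
      using C1c_support[OF \<theta>] by blast
    have B': "\<theta> t = 0" "\<theta>' t = 0" if "t > B" for t
      using B that by auto
    have sub: "continuous_on {0..B} f" if "continuous_on {0..} f" for f :: "real \<Rightarrow> real"
      using that by (rule continuous_on_subset) auto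
    have cA: "continuous_on {0..B} (\<lambda>t. \<theta>' t * ?G t + \<theta> t * ?h1 t)"
      by (intro continuous_on_add continuous_on_mult[OF C1c_continuous'[OF \<theta>] sub[OF cG]]
          continuous_on_mult[OF C1c_continuous[OF \<theta>] sub[OF c1]])
    have cB: "continuous_on {0..B} (\<lambda>t. \<theta> t * ?h2 t)"
      by (rule continuous_on_mult[OF C1c_continuous[OF \<theta>] sub[OF c2]])
    have cC: "continuous_on {0..B} (\<lambda>t. \<theta>' t * ?G t + \<theta> t * (?h1 t + ?h2 t))"
      by (rule continuous_on_add[OF continuous_on_mult[OF C1c_continuous'[OF \<theta>] sub[OF cG]]
            continuous_on_mult[OF C1c_continuous[OF \<theta>] sub[OF continuous_on_add[OF c1 c2]]]])
    have inner: "(LINT s:{0..}|lborel. r t s * ((\<theta>' t * exp (\<mu> * t) + \<mu> * exp (\<mu> * t) * \<theta> t) * \<eta> (s - t)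
          + - \<eta>' (s - t) * (\<theta> t * exp (\<mu> * t)) + \<theta> t * exp (\<mu> * t) * \<eta>' (s - t)
          - (\<mu> + K / (LINT s:{\<tau>..}|lborel. r t s) * indicator {\<tau>..} s) * (\<theta> t * exp (\<mu> * t) * \<eta> (s - t))))
        = \<theta>' t * ?G t + \<theta> t * ?h1 t" (is "?I = _") if t: "t \<ge> 0" for t
    proof -
      have "?I = (LINT s|lborel. (\<theta>' t * exp (\<mu> * t)) * (R t s * \<eta> (s - t))
          - (\<theta> t * exp (\<mu> * t) * k t) * (R t s * (indicator {\<tau>..} s * \<eta> (s - t))))"
        unfolding set_lebesgue_integral_def[of lborel "{0..}"] A_eq k_def[symmetric]
        by (intro Bochner_Integration.integral_cong) (simp_all add: R_def algebra_simps)
      also have "\<dots> = (LINT s|lborel. (\<theta>' t * exp (\<mu> * t)) * (R t s * \<eta> (s - t)))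
          - (LINT s|lborel. (\<theta> t * exp (\<mu> * t) * k t) * (R t s * (indicator {\<tau>..} s * \<eta> (s - t))))"
        by (intro Bochner_Integration.integral_diff integrable_mult_right PQ_integrable[OF \<eta> t])
      also have "\<dots> = \<theta>' t * ?G t + \<theta> t * ?h1 t"
        by (simp add: P_def Q_def)
      finally show ?thesis .
    qed
    \<comment> \<open>The initial term of the weak formulation is the boundary term at 0 that
      \<open>distributional_ODE\<close> expects.\<close>
    have init: "(LINT s:{0..}|lborel. r 0 s * (\<theta> 0 * exp (\<mu> * 0) * \<eta> (s - 0))) = \<theta> 0 * ?G 0"
    proof -
      have "(LINT s:{0..}|lborel. r 0 s * (\<theta> 0 * exp (\<mu> * 0) * \<eta> (s - 0)))
          = (LINT s|lborel. \<theta> 0 * (R 0 s * \<eta> (s - 0)))"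
        unfolding set_lebesgue_integral_def
        by (intro Bochner_Integration.integral_cong) (simp_all add: R_def)
      then show ?thesis by (simp add: P_def)
    qed
    have "(LINT t:{0..}|lborel. (LINT s:{0..}|lborel. r t s * ((\<theta>' t * exp (\<mu> * t) + \<mu> * exp (\<mu> * t) * \<theta> t) * \<eta> (s - t)
          + - \<eta>' (s - t) * (\<theta> t * exp (\<mu> * t)) + \<theta> t * exp (\<mu> * t) * \<eta>' (s - t)
          - (\<mu> + K / (LINT s:{\<tau>..}|lborel. r t s) * indicator {\<tau>..} s) * (\<theta> t * exp (\<mu> * t) * \<eta> (s - t)))))
        + (LINT s:{0..}|lborel. r 0 s * (\<theta> 0 * exp (\<mu> * 0) * \<eta> (s - 0)))
        + (LINT t:{0..}|lborel. (\<mu> * N + K) * (\<theta> t * exp (\<mu> * t) * \<eta> (0 - t))) = 0"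
      using r_weak test_function_transported[OF \<theta> \<eta>, of \<mu>] unfolding weak_transport_def by blast
    moreover have "(LINT t:{0..}|lborel. (LINT s:{0..}|lborel. r t s * ((\<theta>' t * exp (\<mu> * t) + \<mu> * exp (\<mu> * t) * \<theta> t) * \<eta> (s - t)
          + - \<eta>' (s - t) * (\<theta> t * exp (\<mu> * t)) + \<theta> t * exp (\<mu> * t) * \<eta>' (s - t)
          - (\<mu> + K / (LINT s:{\<tau>..}|lborel. r t s) * indicator {\<tau>..} s) * (\<theta> t * exp (\<mu> * t) * \<eta> (s - t)))))
        = (LINT t:{0..}|lborel. \<theta>' t * ?G t + \<theta> t * ?h1 t)"
      by (rule set_lebesgue_integral_cong) (simp, intro allI impI, rule inner, simp)
    moreover have "(LINT t:{0..}|lborel. \<theta>' t * ?G t + \<theta> t * ?h1 t) = integral {0..B} (\<lambda>t. \<theta>' t * ?G t + \<theta> t * ?h1 t)"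
      by (rule LINT_half_line_eq_integral[OF cA]) (simp add: B')
    moreover have "(LINT t:{0..}|lborel. (\<mu> * N + K) * (\<theta> t * exp (\<mu> * t) * \<eta> (0 - t))) = (LINT t:{0..}|lborel. \<theta> t * ?h2 t)"
      by (simp add: mult_ac)
    moreover have "(LINT t:{0..}|lborel. \<theta> t * ?h2 t) = integral {0..B} (\<lambda>t. \<theta> t * ?h2 t)"
      by (rule LINT_half_line_eq_integral[OF cB]) (simp add: B')
    moreover have "(LINT t:{0..}|lborel. \<theta>' t * ?G t + \<theta> t * (?h1 t + ?h2 t))
        = integral {0..B} (\<lambda>t. \<theta>' t * ?G t + \<theta> t * (?h1 t + ?h2 t))"
      by (rule LINT_half_line_eq_integral[OF cC]) (simp add: B')
    moreover have "integral {0..B} (\<lambda>t. \<theta>' t * ?G t + \<theta> t * (?h1 t + ?h2 t))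
        = integral {0..B} (\<lambda>t. (\<theta>' t * ?G t + \<theta> t * ?h1 t) + \<theta> t * ?h2 t)"
      by (simp only: distrib_left add.assoc)
    moreover have "\<dots> = integral {0..B} (\<lambda>t. \<theta>' t * ?G t + \<theta> t * ?h1 t) + integral {0..B} (\<lambda>t. \<theta> t * ?h2 t)"
      by (rule Henstock_Kurzweil_Integration.integral_add[OF integrable_continuous_real[OF cA] integrable_continuous_real[OF cB]])
    ultimately show "(LINT t:{0..}|lborel. \<theta>' t * ?G t + \<theta> t * (?h1 t + ?h2 t)) + \<theta> 0 * ?G 0 = 0"
      using init by linarith
  qed
  have e: "?h1 t + ?h2 t = exp (\<mu> * t) * ((\<mu> * N + K) * \<eta> (- t) - k t * Q \<eta> t)" for t
    by (simp only: right_diff_distrib mult.assoc mult.left_commute)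
  show ?thesis
    using main unfolding e by (simp only: mult_zero_right exp_zero mult_1)
qed

text \<open>Formally this is \<open>P\<close> with weight 1. The promoted flow
  \<open>k t * A t\<close> is the constant \<open>K\<close> and cancels the \<open>K\<close> in the
  inflow, so the nonlinearity drops out of the mass balance. Weight 1 lacks bounded support;
  plateaus exhausting the line replace it, and dominated convergence gives the limit.\<close>

lemma mass_eq:
  assumes T: "T \<ge> 0"
  shows "mass T = N + (mass 0 - N) * exp (- \<mu> * T)"
proof -
  let ?\<eta> = "\<lambda>n. plateau n (- real n) (real n)"
  have "\<forall>n. \<exists>\<eta>'. C1c (?\<eta> n) \<eta>'"
    using plateau_C1c by blast
  then obtain \<eta>' where \<eta>': "\<And>n. C1c (?\<eta> n) (\<eta>' n)"
    by (rule choice[THEN exE]) blast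
  have lim: "(\<lambda>n. ?\<eta> n x) \<longlonglongrightarrow> 1" for x
  proof -
    \<comment> \<open>The margin 1 keeps \<open>x\<close> at distance at least 1 from both ends of
      the plateau, and a slope of at least 1 then brings both ramps to 1.\<close>
    obtain m where m: "\<bar>x\<bar> + 1 < real m"
      using reals_Archimedean2 by blast
    have "?\<eta> n x = 1" if "n \<ge> m" for n
    proof -
      have n: "real n \<ge> real m" using that by simp
      have "real n \<ge> 1" "x - - real n \<ge> 1" "real n - x \<ge> 1" using m n by linarith+
      then have "real n * (x - - real n) \<ge> 1 * 1" "real n * (real n - x) \<ge> 1 * 1"
        by (intro mult_mono; simp)+
      then show ?thesis by (simp add: plateau_def ramp_eq_1)
    qed
    then show ?thesis
      by (intro tendsto_eventually eventually_sequentiallyI)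
  qed
  have [measurable]: "?\<eta> n \<in> borel_measurable borel" for n
    using C1c_measurable(1)[OF \<eta>'] .
  have limP: "(\<lambda>n. P (?\<eta> n) t) \<longlonglongrightarrow> mass t" if t: "t \<ge> 0" for t
  proof -
    note [measurable] = borel_measurable_integrable[OF R_integrable[OF t]]
    have "(\<lambda>n. LINT s|lborel. R t s * ?\<eta> n (s - t)) \<longlonglongrightarrow> (LINT s|lborel. R t s * 1)"
    proof (rule integral_dominated_convergence[where w="\<lambda>s. \<bar>R t s\<bar>"])
      show "AE s in lborel. (\<lambda>n. R t s * ?\<eta> n (s - t)) \<longlonglongrightarrow> R t s * 1"
        by (intro AE_I2 tendsto_mult tendsto_const lim)
      show "AE s in lborel. norm (R t s * ?\<eta> n (s - t)) \<le> \<bar>R t s\<bar>" for n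
        using plateau_bounds by (intro AE_I2) (simp add: abs_mult mult_left_le)
      show "integrable lborel (\<lambda>s. \<bar>R t s\<bar>)" using R_integrable[OF t] by simp
    qed simp_all
    then show ?thesis by (simp add: P_def mass_def)
  qed
  have bndQ: "\<bar>Q (?\<eta> n) t\<bar> \<le> (LINT s|lborel. \<bar>R t s\<bar>)" if t: "t \<ge> 0" for t n
  proof -
    have "\<bar>Q (?\<eta> n) t\<bar> \<le> (LINT s|lborel. \<bar>R t s * (indicator {\<tau>..} s * ?\<eta> n (s - t))\<bar>)"
      unfolding Q_def by (rule integral_abs_bound)
    also have "\<dots> \<le> (LINT s|lborel. \<bar>R t s\<bar>)"
    proof (rule integral_mono)
      show "integrable lborel (\<lambda>s. \<bar>R t s * (indicator {\<tau>..} s * ?\<eta> n (s - t))\<bar>)"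
        by (rule integrable_abs[OF PQ_integrable(2)[OF \<eta>' t]])
      show "integrable lborel (\<lambda>s. \<bar>R t s\<bar>)" using R_integrable[OF t] by simp
      show "\<bar>R t s * (indicator {\<tau>..} s * ?\<eta> n (s - t))\<bar> \<le> \<bar>R t s\<bar>" for s
        using plateau_bounds by (cases "s \<ge> \<tau>") (simp_all add: abs_mult mult_left_le)
    qed
    finally show ?thesis .
  qed
  have limQ: "(\<lambda>n. Q (?\<eta> n) t) \<longlonglongrightarrow> A t" if t: "t \<ge> 0" for t
  proof -
    note [measurable] = borel_measurable_integrable[OF R_integrable[OF t]]
    have "(\<lambda>n. LINT s|lborel. R t s * (indicator {\<tau>..} s * ?\<eta> n (s - t))) \<longlonglongrightarrow> (LINT s|lborel. R t s * (indicator {\<tau>..} s * 1))"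
    proof (rule integral_dominated_convergence[where w="\<lambda>s. \<bar>R t s\<bar>"])
      show "AE s in lborel. (\<lambda>n. R t s * (indicator {\<tau>..} s * ?\<eta> n (s - t))) \<longlonglongrightarrow> R t s * (indicator {\<tau>..} s * 1)"
        by (intro AE_I2 tendsto_mult tendsto_const lim)
      show "AE s in lborel. norm (R t s * (indicator {\<tau>..} s * ?\<eta> n (s - t))) \<le> \<bar>R t s\<bar>" for n
      proof (rule AE_I2)
        show "norm (R t s * (indicator {\<tau>..} s * ?\<eta> n (s - t))) \<le> \<bar>R t s\<bar>" for s
          using plateau_bounds by (cases "s \<ge> \<tau>") (simp_all add: abs_mult mult_left_le)
      qed
      show "integrable lborel (\<lambda>s. \<bar>R t s\<bar>)" using R_integrable[OF t] by simp
    qed simp_all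
    then show ?thesis by (simp add: Q_def A_def)
  qed
  \<comment> \<open>The majorant \<open>?w\<close> used below contains the L^1 norm of
    \<open>R t\<close>; continuity of this norm makes \<open>?w\<close> integrable over
    \<open>{0..T}\<close>.\<close>
  have cl1: "continuous_on {0..} (\<lambda>t. LINT s|lborel. \<bar>R t s\<bar>)"
    unfolding continuous_on_def
  proof
    fix t :: real assume "t \<in> {0..}"
    then have t: "t \<ge> 0" by simp
    have "\<bar>(LINT s|lborel. \<bar>R u s\<bar>) - (LINT s|lborel. \<bar>R t s\<bar>)\<bar> \<le> (LINT s|lborel. \<bar>R u s - R t s\<bar>)" if u: "u \<ge> 0" for u
    proof -
      have iu: "integrable lborel (\<lambda>s. \<bar>R u s\<bar>)" and it: "integrable lborel (\<lambda>s. \<bar>R t s\<bar>)"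
        using R_integrable t u by auto
      have "(LINT s|lborel. \<bar>R u s\<bar>) - (LINT s|lborel. \<bar>R t s\<bar>) = (LINT s|lborel. \<bar>R u s\<bar> - \<bar>R t s\<bar>)"
        by (rule Bochner_Integration.integral_diff[OF iu it, symmetric])
      then have "\<bar>(LINT s|lborel. \<bar>R u s\<bar>) - (LINT s|lborel. \<bar>R t s\<bar>)\<bar> \<le> (LINT s|lborel. \<bar>\<bar>R u s\<bar> - \<bar>R t s\<bar>\<bar>)"
        using integral_abs_bound[of lborel "\<lambda>s. \<bar>R u s\<bar> - \<bar>R t s\<bar>"] by simp
      also have "\<dots> \<le> (LINT s|lborel. \<bar>R u s - R t s\<bar>)"
        by (rule integral_mono[OF integrable_abs[OF Bochner_Integration.integrable_diff[OF iu it]]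
             integrable_abs[OF Bochner_Integration.integrable_diff[OF R_integrable[OF u] R_integrable[OF t]]]]) simp
      finally show ?thesis .
    qed
    then have "\<forall>\<^sub>F u in at t within {0..}. norm ((LINT s|lborel. \<bar>R u s\<bar>) - (LINT s|lborel. \<bar>R t s\<bar>)) \<le> (LINT s|lborel. \<bar>R u s - R t s\<bar>)"
      by (auto simp: eventually_at_filter)
    from Lim_null_comparison[OF this R_L1_tendsto[OF t]]
    show "((\<lambda>u. LINT s|lborel. \<bar>R u s\<bar>) \<longlongrightarrow> (LINT s|lborel. \<bar>R t s\<bar>)) (at t within {0..})"
      by (rule Lim_null[THEN iffD2])
  qed
  let ?F = "\<lambda>n t. exp (\<mu> * t) * ((\<mu> * N + K) * ?\<eta> n (- t) - k t * Q (?\<eta> n) t)"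
  let ?w = "\<lambda>t. exp (\<mu> * t) * (\<bar>\<mu> * N + K\<bar> + k t * (LINT s|lborel. \<bar>R t s\<bar>))"
  have sub: "continuous_on {0..T} f" if "continuous_on {0..} f" for f :: "real \<Rightarrow> real"
    using that by (rule continuous_on_subset) auto
  have ce: "continuous_on S (\<lambda>t. exp (\<mu> * t))" for S by (intro continuous_intros)
  have "(\<lambda>n. integral {0..T} (?F n)) \<longlonglongrightarrow> integral {0..T} (\<lambda>t. exp (\<mu> * t) * ((\<mu> * N + K) * 1 - k t * A t))"
  proof (rule dominated_convergence(2)[where h="?w"])
    have cn: "continuous_on S (\<lambda>t. ?\<eta> n (- t))" for S n
      by (rule continuous_on_compose2[OF C1c_continuous[OF \<eta>', of UNIV]]) (auto intro: continuous_intros)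
    show "?F n integrable_on {0..T}" for n
      by (rule integrable_continuous_real, rule continuous_on_mult[OF ce],
          rule continuous_on_diff[OF continuous_on_mult[OF continuous_on_const cn]
            continuous_on_mult[OF sub[OF k_continuous] sub[OF PQ_continuous(2)[OF \<eta>']]]])
    show "?w integrable_on {0..T}"
      by (rule integrable_continuous_real, rule continuous_on_mult[OF ce],
          rule continuous_on_add[OF continuous_on_const continuous_on_mult[OF sub[OF k_continuous] sub[OF cl1]]])
    show "norm (?F n t) \<le> ?w t" if "t \<in> {0..T}" for n t
    proof -
      have t: "t \<ge> 0" using that by simp
      have "\<bar>(\<mu> * N + K) * ?\<eta> n (- t) - k t * Q (?\<eta> n) t\<bar> \<le> \<bar>(\<mu> * N + K) * ?\<eta> n (- t)\<bar> + \<bar>k t * Q (?\<eta> n) t\<bar>"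
        by (rule abs_triangle_ineq4)
      also have "\<dots> = \<bar>\<mu> * N + K\<bar> * ?\<eta> n (- t) + k t * \<bar>Q (?\<eta> n) t\<bar>"
        using plateau_bounds(1) k_nonneg[OF t] by (simp add: abs_mult)
      also have "\<dots> \<le> \<bar>\<mu> * N + K\<bar> + k t * (LINT s|lborel. \<bar>R t s\<bar>)"
        by (rule add_mono[OF mult_left_le[OF plateau_bounds(2) abs_ge_zero] mult_left_mono[OF bndQ[OF t] k_nonneg[OF t]]])
      finally show ?thesis by (simp add: abs_mult)
    qed
    show "(\<lambda>n. ?F n t) \<longlonglongrightarrow> exp (\<mu> * t) * ((\<mu> * N + K) * 1 - k t * A t)" if "t \<in> {0..T}" for t
      by (intro tendsto_mult tendsto_diff tendsto_const lim limQ) (use that in simp)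
  qed
  then have l1: "(\<lambda>n. P (?\<eta> n) 0 + integral {0..T} (?F n))
      \<longlonglongrightarrow> mass 0 + integral {0..T} (\<lambda>t. exp (\<mu> * t) * ((\<mu> * N + K) * 1 - k t * A t))"
    by (intro tendsto_add limP) simp_all
  have l2: "(\<lambda>n. exp (\<mu> * T) * P (?\<eta> n) T) \<longlonglongrightarrow> exp (\<mu> * T) * mass T"
    by (intro tendsto_mult tendsto_const limP T)
  have e: "P (?\<eta> n) 0 + integral {0..T} (?F n) = exp (\<mu> * T) * P (?\<eta> n) T" for n
    using P_evolution[OF \<eta>' T] by simp
  have "exp (\<mu> * T) * mass T = mass 0 + integral {0..T} (\<lambda>t. exp (\<mu> * t) * ((\<mu> * N + K) * 1 - k t * A t))"
    using LIMSEQ_unique[OF l2 l1[unfolded e]] .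
  also have "integral {0..T} (\<lambda>t. exp (\<mu> * t) * ((\<mu> * N + K) * 1 - k t * A t))
      = integral {0..T} (\<lambda>t. exp (\<mu> * t) * (\<mu> * N))"
    by (rule Henstock_Kurzweil_Integration.integral_cong) (simp add: k_times_A)
  also have "\<dots> = N * exp (\<mu> * T) - N * exp (\<mu> * 0)"
  proof (rule integral_unique, rule fundamental_theorem_of_calculus[OF T])
    fix t
    have "((\<lambda>t. N * exp (\<mu> * t)) has_real_derivative exp (\<mu> * t) * (\<mu> * N)) (at t within {0..T})"
      by (auto intro!: derivative_eq_intros)
    then show "((\<lambda>t. N * exp (\<mu> * t)) has_vector_derivative exp (\<mu> * t) * (\<mu> * N)) (at t within {0..T})"
      by (simp add: has_real_derivative_iff_has_vector_derivative)
  qed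
  finally have "exp (\<mu> * T) * mass T = exp (\<mu> * T) * (N + (mass 0 - N) * exp (- \<mu> * T))"
    by (simp add: algebra_simps exp_minus)
  then show ?thesis
    by (rule mult_left_cancel[THEN iffD1, rotated]) (rule exp_not_eq_zero)
qed

end

section \<open>Comparison of two solutions of one level\<close>

lemma C1c_shift:
  assumes "C1c \<eta> \<eta>'"
  shows "C1c (\<lambda>x. \<eta> (x + T)) (\<lambda>x. \<eta>' (x + T))"
  unfolding C1c_def
proof (intro conjI allI)
  show "((\<lambda>x. \<eta> (x + T)) has_real_derivative \<eta>' (x + T)) (at x)" for x
    using DERIV_shift[of \<eta> "\<eta>' (x + T)" x T] C1c_DERIV[OF assms, of "x + T"] by blast
  show "continuous_on UNIV (\<lambda>x. \<eta>' (x + T))"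
    by (rule continuous_on_compose2[OF C1c_continuous'[OF assms, of UNIV]]) (auto intro: continuous_intros)
  obtain B where "B > 0" and B: "\<And>x. \<bar>x\<bar> > B \<Longrightarrow> \<eta> x = 0" "\<And>x. \<bar>x\<bar> > B \<Longrightarrow> \<eta>' x = 0"
    using C1c_support[OF assms] by blast
  have "{x. \<eta> (x + T) \<noteq> 0} \<subseteq> {- B - T..B - T}"
  proof
    fix x assume "x \<in> {x. \<eta> (x + T) \<noteq> 0}"
    then have "\<not> \<bar>x + T\<bar> > B" using B(1)[of "x + T"] by auto
    then show "x \<in> {- B - T..B - T}" by auto
  qed
  then show "bounded {x. \<eta> (x + T) \<noteq> 0}"
    by (rule bounded_subset[rotated]) simp
qed

lemma AE_eq_0_if_all_test_integrals_0:
  fixes f :: "real \<Rightarrow> real"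
  assumes "integrable lborel f" "\<And>\<eta> \<eta>'. C1c \<eta> \<eta>' \<Longrightarrow> (LINT x|lborel. f x * \<eta> x) = 0"
  shows "AE x in lborel. f x = 0"
proof -
  have "AE x in lborel. x < real n \<longrightarrow> f x = 0" for n
    using assms by (intro AE_eq_0_if_test_integrals_0) auto
  then have "AE x in lborel. \<forall>n. x < real n \<longrightarrow> f x = 0"
    by (rule AE_all_countable[THEN iffD2, rule_format])
  then show ?thesis
    by eventually_elim (meson reals_Archimedean2)
qed

lemma LINT_shift:
  fixes f :: "real \<Rightarrow> real"
  shows "(LINT x|lborel. f (x + c)) = (LINT x|lborel. f x)"
  using lborel_integral_real_affine[of 1 f c] by (simp add: add.commute)

lemma integrable_shift:
  fixes f :: "real \<Rightarrow> real"
  assumes "integrable lborel f"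
  shows "integrable lborel (\<lambda>x. f (x + c))"
  using lborel_integrable_real_affine[OF assms, of 1 c] by (simp add: add.commute)

locale job_level_pair = a: job_level \<mu> N K \<tau> r + b: job_level \<mu> N K \<tau> r'
  for \<mu> N K \<tau> r r'
begin

text \<open>Test functions carried by characteristics that stay below \<open>\<tau>\<close> up to time \<open>T\<close> do not see the
  promotion term, hence not the nonlinearity.\<close>

lemma young_part_eq:
  assumes T: "0 \<le> T" and start: "\<tau> \<le> T \<or> (AE s in lborel. a.R 0 s = b.R 0 s)"
  shows "AE s in lborel. s < \<tau> \<longrightarrow> a.R T s = b.R T s"
proof -
  have "AE s in lborel. s < \<tau> \<longrightarrow> a.R T s - b.R T s = 0"
  proof (rule AE_eq_0_if_test_integrals_0)
    show "integrable lborel (\<lambda>s. a.R T s - b.R T s)"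
      by (intro Bochner_Integration.integrable_diff a.R_integrable b.R_integrable T)
    fix \<eta> \<eta>' assume \<eta>: "C1c \<eta> \<eta>'" and z: "\<And>x. x \<ge> \<tau> \<Longrightarrow> \<eta> x = 0"
    \<comment> \<open>The shift by \<open>T\<close> undoes the transport: pairing with
      \<open>\<zeta>\<close> at time \<open>T\<close> is pairing with \<open>\<eta>\<close>
      itself.\<close>
    define \<zeta> where "\<zeta> x = \<eta> (x + T)" for x
    have \<zeta>: "C1c \<zeta> (\<lambda>x. \<eta>' (x + T))"
      using C1c_shift[OF \<eta>, of T] by (simp add: \<zeta>_def[abs_def])
    \<comment> \<open>For \<open>s \<ge> \<tau>\<close> and \<open>t \<le> T\<close> the argument
      \<open>s - t + T\<close> is at least \<tau>, where \<open>\<eta>\<close> vanishes.\<close>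
    have Q0: "a.Q \<zeta> t = 0" "b.Q \<zeta> t = 0" if "t \<in> {0..T}" for t
    proof -
      have z0: "indicator {\<tau>..} s * \<zeta> (s - t) = 0" for s
        using that by (cases "s \<ge> \<tau>") (simp_all add: \<zeta>_def z)
      then show "a.Q \<zeta> t = 0" "b.Q \<zeta> t = 0" unfolding a.Q_def b.Q_def z0 by simp_all
    qed
    have "a.P \<zeta> 0 = b.P \<zeta> 0"
      using start
    proof
      \<comment> \<open>The initial data are invisible here: for \<open>s \<ge> 0\<close> the
        argument \<open>s + T\<close> is at least \<tau>, and for \<open>s < 0\<close> both
        extensions are 0.\<close>
      assume "\<tau> \<le> T"
      then have z0: "a.R 0 s * \<zeta> (s - 0) = 0" "b.R 0 s * \<zeta> (s - 0) = 0" for s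
        by (cases "s \<ge> 0"; simp add: \<zeta>_def z a.R_def b.R_def)+
      show ?thesis unfolding a.P_def b.P_def z0 ..
    next
      note [measurable] = C1c_measurable(1)[OF \<zeta>] borel_measurable_integrable[OF a.R_integrable[OF order_refl]]
        borel_measurable_integrable[OF b.R_integrable[OF order_refl]]
      assume "AE s in lborel. a.R 0 s = b.R 0 s"
      then have "AE s in lborel. a.R 0 s * \<zeta> (s - 0) = b.R 0 s * \<zeta> (s - 0)"
        by eventually_elim simp
      then show ?thesis
        unfolding a.P_def b.P_def by (intro integral_cong_AE) simp_all
    qed
    moreover have "integral {0..T} (\<lambda>t. exp (\<mu> * t) * ((\<mu> * N + K) * \<zeta> (- t) - a.k t * a.Q \<zeta> t))
        = integral {0..T} (\<lambda>t. exp (\<mu> * t) * ((\<mu> * N + K) * \<zeta> (- t) - b.k t * b.Q \<zeta> t))"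
      by (rule Henstock_Kurzweil_Integration.integral_cong) (simp only: Q0 mult_zero_right)
    ultimately have "exp (\<mu> * T) * a.P \<zeta> T = exp (\<mu> * T) * b.P \<zeta> T"
      unfolding a.P_evolution[OF \<zeta> T] b.P_evolution[OF \<zeta> T] by (simp only:)
    then have "a.P \<zeta> T = b.P \<zeta> T"
      by (rule mult_left_cancel[THEN iffD1, rotated]) (rule exp_not_eq_zero)
    then have "(LINT s|lborel. a.R T s * \<eta> s) = (LINT s|lborel. b.R T s * \<eta> s)"
      by (simp add: a.P_def b.P_def \<zeta>_def)
    moreover have "(LINT s|lborel. (a.R T s - b.R T s) * \<eta> s) = (LINT s|lborel. a.R T s * \<eta> s) - (LINT s|lborel. b.R T s * \<eta> s)"
      using integrable_mult_C1c(1)[OF a.R_integrable[OF T] \<eta>, of 0] integrable_mult_C1c(1)[OF b.R_integrable[OF T] \<eta>, of 0]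
      by (simp add: left_diff_distrib)
    ultimately show "(LINT s|lborel. (a.R T s - b.R T s) * \<eta> s) = 0" by linarith
  qed
  then show ?thesis by eventually_elim simp
qed

text \<open>The second alternative in \<open>start\<close> serves uniqueness: solutions with the
  same initial datum have equal eligible masses from time 0 on, without waiting until
  \<tau>.\<close>

lemma A_agree:
  assumes T: "0 \<le> T" and start: "\<tau> \<le> T \<or> (AE s in lborel. a.R 0 s = b.R 0 s)"
    and mass: "a.mass 0 = b.mass 0"
  shows "a.A T = b.A T"
proof -
  note [measurable] = borel_measurable_integrable[OF a.R_integrable[OF T]]
        borel_measurable_integrable[OF b.R_integrable[OF T]]
  have ae: "AE s in lborel. a.R T s * indicator {..<\<tau>} s = b.R T s * indicator {..<\<tau>} s"
    using young_part_eq[OF T start] by eventually_elim (auto simp: indicator_def)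
  have "(LINT s|lborel. a.R T s * indicator {..<\<tau>} s) = (LINT s|lborel. b.R T s * indicator {..<\<tau>} s)"
    by (rule integral_cong_AE[OF _ _ ae]) simp_all
  moreover have "a.mass T = b.mass T"
    using a.mass_eq[OF T] b.mass_eq[OF T] mass by simp
  moreover have split: "(LINT s|lborel. f s) = (LINT s|lborel. f s * indicator {..<\<tau>} s) + (LINT s|lborel. f s * indicator {\<tau>..} s)"
    if f: "integrable lborel f" for f :: "real \<Rightarrow> real"
  proof -
    have "(LINT s|lborel. f s) = (LINT s|lborel. f s * indicator {..<\<tau>} s + f s * indicator {\<tau>..} s)"
      by (rule Bochner_Integration.integral_cong) (auto simp: indicator_def)
    also have "\<dots> = (LINT s|lborel. f s * indicator {..<\<tau>} s) + (LINT s|lborel. f s * indicator {\<tau>..} s)"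
      by (rule Bochner_Integration.integral_add; rule integrable_real_mult_indicator[OF _ f]) simp_all
    finally show ?thesis .
  qed
  ultimately show ?thesis
    using split[OF a.R_integrable[OF T]] split[OF b.R_integrable[OF T]]
    unfolding a.mass_def b.mass_def a.A_def b.A_def by linarith
qed

text \<open>From \<open>t0\<close> on the rates agree and the difference of the solutions sits on
  seniorities of at least \<tau>, so the differences of the \<open>P\<close> and of the
  \<open>Q\<close> pairings coincide. This closes the evolution equation into
  \<open>D' = - a.k * D\<close>, which an integrating factor solves.\<close>

lemma old_pairing_decay:
  assumes t0: "0 \<le> t0" "t0 \<le> T" and start: "\<tau> \<le> t0 \<or> (AE s in lborel. a.R 0 s = b.R 0 s)"
    and mass: "a.mass 0 = b.mass 0" and \<eta>: "C1c \<eta> \<eta>'"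
  shows "exp (\<mu> * T) * (a.P \<eta> T - b.P \<eta> T)
    = exp (- integral {t0..T} a.k) * (exp (\<mu> * t0) * (a.P \<eta> t0 - b.P \<eta> t0))"
proof -
  define D where "D t = exp (\<mu> * t) * (a.P \<eta> t - b.P \<eta> t)" for t
  define h where "h t = exp (\<mu> * t) * ((\<mu> * N + K) * \<eta> (- t) - a.k t * a.Q \<eta> t)
     - exp (\<mu> * t) * ((\<mu> * N + K) * \<eta> (- t) - b.k t * b.Q \<eta> t)" for t
  have ce: "continuous_on S (\<lambda>t. exp (\<mu> * t))" for S by (intro continuous_intros)
  have cn: "continuous_on S (\<lambda>t. \<eta> (- t))" for S
    by (rule continuous_on_compose2[OF C1c_continuous[OF \<eta>, of UNIV]]) (auto intro: continuous_intros)
  have cha: "continuous_on {0..} (\<lambda>t. exp (\<mu> * t) * ((\<mu> * N + K) * \<eta> (- t) - a.k t * a.Q \<eta> t))"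
    by (rule continuous_on_mult[OF ce continuous_on_diff[OF continuous_on_mult[OF continuous_on_const cn]
       continuous_on_mult[OF a.k_continuous a.PQ_continuous(2)[OF \<eta>]]]])
  have chb: "continuous_on {0..} (\<lambda>t. exp (\<mu> * t) * ((\<mu> * N + K) * \<eta> (- t) - b.k t * b.Q \<eta> t))"
    by (rule continuous_on_mult[OF ce continuous_on_diff[OF continuous_on_mult[OF continuous_on_const cn]
       continuous_on_mult[OF b.k_continuous b.PQ_continuous(2)[OF \<eta>]]]])
  have ch: "continuous_on {0..} h"
    unfolding h_def[abs_def] by (rule continuous_on_diff[OF cha chb])
  have sub: "continuous_on {c..d} f" if "continuous_on {0..} f" "0 \<le> c" for f :: "real \<Rightarrow> real" and c d
    using that(1) by (rule continuous_on_subset) (use that(2) in auto)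
  have D_eq: "D t = D 0 + integral {0..t} h" if t: "0 \<le> t" for t
  proof -
    have "integral {0..t} h = integral {0..t} (\<lambda>t. exp (\<mu> * t) * ((\<mu> * N + K) * \<eta> (- t) - a.k t * a.Q \<eta> t))
       - integral {0..t} (\<lambda>t. exp (\<mu> * t) * ((\<mu> * N + K) * \<eta> (- t) - b.k t * b.Q \<eta> t))"
      unfolding h_def[abs_def]
      by (rule Henstock_Kurzweil_Integration.integral_diff;
          rule integrable_continuous_real, rule sub[OF _ order_refl], rule cha chb)
    then show ?thesis
      using a.P_evolution[OF \<eta> t] b.P_evolution[OF \<eta> t]
      unfolding D_def right_diff_distrib[of "exp _"] mult_zero_right exp_zero mult_1 by linarith
  qed
  have h_eq: "h t = - (a.k t * D t)" if "t0 \<le> t" for t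
  proof -
    have t: "0 \<le> t" using t0 that by simp
    have start': "\<tau> \<le> t \<or> (AE s in lborel. a.R 0 s = b.R 0 s)" using start that by auto
    have k_eq: "b.k t = a.k t"
      using A_agree[OF t start' mass] by (simp add: a.k_def b.k_def)
    note [measurable] = C1c_measurable(1)[OF \<eta>] borel_measurable_integrable[OF a.R_integrable[OF t]]
        borel_measurable_integrable[OF b.R_integrable[OF t]]
    have ae: "AE s in lborel. a.R t s * \<eta> (s - t) - b.R t s * \<eta> (s - t)
       = a.R t s * (indicator {\<tau>..} s * \<eta> (s - t)) - b.R t s * (indicator {\<tau>..} s * \<eta> (s - t))"
      using young_part_eq[OF t start'] by eventually_elim (auto simp: indicator_def)
    have "a.P \<eta> t - b.P \<eta> t = (LINT s|lborel. a.R t s * \<eta> (s - t) - b.R t s * \<eta> (s - t))"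
      unfolding a.P_def b.P_def
      by (rule Bochner_Integration.integral_diff[symmetric, OF a.PQ_integrable(1)[OF \<eta> t] b.PQ_integrable(1)[OF \<eta> t]])
    also have "\<dots> = (LINT s|lborel. a.R t s * (indicator {\<tau>..} s * \<eta> (s - t)) - b.R t s * (indicator {\<tau>..} s * \<eta> (s - t)))"
      by (rule integral_cong_AE[OF _ _ ae]) simp_all
    also have "\<dots> = a.Q \<eta> t - b.Q \<eta> t"
      unfolding a.Q_def b.Q_def
      by (rule Bochner_Integration.integral_diff[OF a.PQ_integrable(2)[OF \<eta> t] b.PQ_integrable(2)[OF \<eta> t]])
    finally have PQ: "a.P \<eta> t - b.P \<eta> t = a.Q \<eta> t - b.Q \<eta> t" .
    show ?thesis
      unfolding h_def D_def k_eq PQ by (simp add: algebra_simps)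
  qed
  let ?J = "\<lambda>t. integral {t0..t} a.k"
  have ck: "continuous_on {t0..d} a.k" for d by (rule sub[OF a.k_continuous t0(1)])
  show ?thesis
  proof (cases "t0 = T")
    case True
    then show ?thesis by simp
  next
    case False
    then have lt: "t0 < T" using t0 by simp
    have "D T * exp (?J T) = D t0 * exp (?J t0)"
    proof (rule DERIV_isconst_end[OF lt])
      \<comment> \<open>The regularity of \<open>D\<close> is read off its integral representation
        \<open>D_eq\<close>.\<close>
      have "continuous_on {t0..T} (\<lambda>t. D 0 + integral {0..t} h)"
        by (rule continuous_on_add[OF continuous_on_const continuous_on_subset[OF
              indefinite_integral_continuous_1[OF integrable_continuous_real[OF sub[OF ch order_refl]]]]]) (use t0 in auto)
      moreover have "continuous_on {t0..T} D \<longleftrightarrow> continuous_on {t0..T} (\<lambda>t. D 0 + integral {0..t} h)"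
        by (rule continuous_on_cong[OF refl], rule D_eq) (use t0 in auto)
      ultimately have "continuous_on {t0..T} D" by simp
      then show "continuous_on {t0..T} (\<lambda>t. D t * exp (?J t))"
        by (rule continuous_on_mult[OF _ continuous_on_exp[OF indefinite_integral_continuous_1[OF integrable_continuous_real[OF ck]]]])
      fix t assume t: "t0 < t" "t < T"
      have "((\<lambda>t. D 0 + integral {0..t} h) has_real_derivative 0 + h t) (at t)"
      proof (rule DERIV_add[OF DERIV_const])
        have "((\<lambda>t. integral {0..t} h) has_real_derivative h t) (at t within {0..T})"
          by (rule integral_has_real_derivative[OF sub[OF ch order_refl]]) (use t t0 in auto)
        then show "((\<lambda>t. integral {0..t} h) has_real_derivative h t) (at t)"
          using t t0 by (subst (asm) at_within_interior) auto
      qed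
      then have dD: "(D has_real_derivative 0 + h t) (at t)"
      proof (rule has_field_derivative_transform_within_open[where S="{t0<..<T}"])
        show "D 0 + integral {0..t} h = D t" if "t \<in> {t0<..<T}" for t
          by (rule D_eq[symmetric]) (use that t0 in auto)
      qed (use t in auto)
      have "(?J has_real_derivative a.k t) (at t within {t0..T})"
        by (rule integral_has_real_derivative[OF ck]) (use t in auto)
      then have "(?J has_real_derivative a.k t) (at t)"
        using t by (subst (asm) at_within_interior) auto
      from DERIV_mult[OF dD DERIV_chain2[OF DERIV_exp this]]
      show "((\<lambda>t. D t * exp (?J t)) has_real_derivative 0) (at t)"
        by (rule DERIV_cong) (use h_eq[of t] t in \<open>simp add: algebra_simps\<close>)
    qed
    then have "D T = exp (- ?J T) * D t0"
      by (simp add: exp_minus field_simps)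
    then show ?thesis unfolding D_def .
  qed
qed

text \<open>Since the pairing identity holds for all test functions, the difference at time
  \<open>T\<close> is almost everywhere \<open>c\<close> times the translate by
  \<open>T - t0\<close> of the difference at time \<open>t0\<close>. Translation preserves the L^1
  norm.\<close>

lemma L1_contraction:
  assumes t0: "0 \<le> t0" "t0 \<le> T" and start: "\<tau> \<le> t0 \<or> (AE s in lborel. a.R 0 s = b.R 0 s)"
    and mass: "a.mass 0 = b.mass 0"
  shows "(LINT s|lborel. \<bar>a.R T s - b.R T s\<bar>) \<le> exp (- \<mu> * (T - t0)) * (LINT s|lborel. \<bar>a.R t0 s - b.R t0 s\<bar>)"
proof -
  have T: "0 \<le> T" using t0 by simp
  \<comment> \<open>Survival factor from \<open>t0\<close> to \<open>T\<close>: turnover at rate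
    \<mu> together with promotion at rate \<open>a.k\<close>.\<close>
  define c where "c = exp (- \<mu> * (T - t0) - integral {t0..T} a.k)"
  define \<delta> where "\<delta> t s = a.R t s - b.R t s" for t s
  have i\<delta>: "integrable lborel (\<delta> t)" if "0 \<le> t" for t
    unfolding \<delta>_def[abs_def] by (rule Bochner_Integration.integrable_diff[OF a.R_integrable[OF that] b.R_integrable[OF that]])
  have i\<delta>s: "integrable lborel (\<lambda>s. \<delta> t0 (s + (t0 - T)))"
    by (rule integrable_shift[OF i\<delta>[OF t0(1)]])
  have "AE s in lborel. \<delta> T s - c * \<delta> t0 (s + (t0 - T)) = 0"
  proof (rule AE_eq_0_if_all_test_integrals_0)
    show "integrable lborel (\<lambda>s. \<delta> T s - c * \<delta> t0 (s + (t0 - T)))"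
      by (intro Bochner_Integration.integrable_diff integrable_mult_right i\<delta>[OF T] i\<delta>s)
    fix \<eta> \<eta>' assume \<eta>: "C1c \<eta> \<eta>'"
    define \<zeta> where "\<zeta> x = \<eta> (x + T)" for x
    have \<zeta>: "C1c \<zeta> (\<lambda>x. \<eta>' (x + T))"
      using C1c_shift[OF \<eta>, of T] by (simp add: \<zeta>_def[abs_def])
    have pair: "a.P \<zeta> t - b.P \<zeta> t = (LINT s|lborel. \<delta> t s * \<zeta> (s - t))" if "0 \<le> t" for t
    proof -
      have "a.P \<zeta> t - b.P \<zeta> t = (LINT s|lborel. a.R t s * \<zeta> (s - t) - b.R t s * \<zeta> (s - t))"
        unfolding a.P_def b.P_def
        by (rule Bochner_Integration.integral_diff[symmetric, OF a.PQ_integrable(1)[OF \<zeta> that] b.PQ_integrable(1)[OF \<zeta> that]])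
      then show ?thesis by (simp add: \<delta>_def left_diff_distrib)
    qed
    have "(LINT s|lborel. \<delta> t0 (s + (t0 - T)) * \<eta> s) = (LINT s|lborel. \<delta> t0 s * \<zeta> (s - t0))"
      using LINT_shift[of "\<lambda>s. \<delta> t0 s * \<zeta> (s - t0)" "t0 - T"] by (simp add: \<zeta>_def)
    moreover have "exp (\<mu> * T) * (LINT s|lborel. \<delta> T s * \<zeta> (s - T))
       = exp (- integral {t0..T} a.k) * (exp (\<mu> * t0) * (LINT s|lborel. \<delta> t0 s * \<zeta> (s - t0)))"
      using old_pairing_decay[OF t0 start mass \<zeta>] unfolding pair[OF T] pair[OF t0(1)] .
    then have "exp (- (\<mu> * T)) * (exp (\<mu> * T) * (LINT s|lborel. \<delta> T s * \<zeta> (s - T)))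
       = exp (- (\<mu> * T)) * (exp (- integral {t0..T} a.k) * (exp (\<mu> * t0) * (LINT s|lborel. \<delta> t0 s * \<zeta> (s - t0))))"
      by (simp only:)
    then have "(LINT s|lborel. \<delta> T s * \<zeta> (s - T)) = c * (LINT s|lborel. \<delta> t0 s * \<zeta> (s - t0))"
      by (simp add: c_def mult.assoc[symmetric] exp_add[symmetric] algebra_simps)
    ultimately have "(LINT s|lborel. \<delta> T s * \<eta> s) = c * (LINT s|lborel. \<delta> t0 (s + (t0 - T)) * \<eta> s)"
      by (simp add: \<zeta>_def)
    moreover have "(LINT s|lborel. (\<delta> T s - c * \<delta> t0 (s + (t0 - T))) * \<eta> s)
       = (LINT s|lborel. \<delta> T s * \<eta> s - c * (\<delta> t0 (s + (t0 - T)) * \<eta> s))"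
      by (simp add: algebra_simps)
    moreover have "\<dots> = (LINT s|lborel. \<delta> T s * \<eta> s) - (LINT s|lborel. c * (\<delta> t0 (s + (t0 - T)) * \<eta> s))"
      using integrable_mult_C1c(1)[OF i\<delta>[OF T] \<eta>, of 0] integrable_mult_C1c(1)[OF i\<delta>s \<eta>, of 0]
      by (intro Bochner_Integration.integral_diff integrable_mult_right) simp_all
    moreover have "(LINT s|lborel. c * (\<delta> t0 (s + (t0 - T)) * \<eta> s)) = c * (LINT s|lborel. \<delta> t0 (s + (t0 - T)) * \<eta> s)"
      by simp
    ultimately show "(LINT s|lborel. (\<delta> T s - c * \<delta> t0 (s + (t0 - T))) * \<eta> s) = 0"
      by linarith
  qed
  then have ae: "AE s in lborel. \<bar>\<delta> T s\<bar> = c * \<bar>\<delta> t0 (s + (t0 - T))\<bar>"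
    by eventually_elim (simp add: c_def abs_mult)
  note [measurable] = borel_measurable_integrable[OF i\<delta>[OF T]] borel_measurable_integrable[OF i\<delta>s]
  have "(LINT s|lborel. \<bar>\<delta> T s\<bar>) = (LINT s|lborel. c * \<bar>\<delta> t0 (s + (t0 - T))\<bar>)"
    by (rule integral_cong_AE[OF _ _ ae]) simp_all
  also have "\<dots> = c * (LINT s|lborel. \<bar>\<delta> t0 s\<bar>)"
    using LINT_shift[of "\<lambda>s. \<bar>\<delta> t0 s\<bar>" "t0 - T"] by simp
  also have "\<dots> \<le> exp (- \<mu> * (T - t0)) * (LINT s|lborel. \<bar>\<delta> t0 s\<bar>)"
  proof (rule mult_right_mono)
    \<comment> \<open>Promotion only removes workers: \<open>a.k\<close> is nonnegative, so its
      contribution to \<open>c\<close> is a factor of at most 1.\<close>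
    have "continuous_on {t0..T} a.k"
      by (rule continuous_on_subset[OF a.k_continuous]) (use t0 in auto)
    then have "0 \<le> integral {t0..T} a.k"
      by (intro Henstock_Kurzweil_Integration.integral_nonneg integrable_continuous_real) (use a.k_nonneg t0 in auto)
    then show "c \<le> exp (- \<mu> * (T - t0))" by (simp add: c_def)
  qed simp
  finally show ?thesis by (simp add: \<delta>_def)
qed

end

section \<open>The explicit profile\<close>

lemma has_bochner_integral_exp_half_line:
  fixes a c :: real
  assumes a: "a > 0"
  shows "has_bochner_integral lborel (\<lambda>s. exp (- a * s) * indicator {c..} s) (exp (- a * c) / a)"
proof (rule has_bochner_integral_nn_integral)
  have "filterlim (\<lambda>x::real. - a * x) at_bot at_top"
    by (rule filterlim_tendsto_neg_mult_at_bot[OF tendsto_const _ filterlim_ident]) (use a in simp)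
  from filterlim_compose[OF exp_at_bot this]
  have lim: "((\<lambda>x. - (exp (- a * x) / a)) \<longlongrightarrow> - (0 / a)) at_top"
    by (intro tendsto_minus tendsto_divide tendsto_const) (use a in auto)
  have "(\<integral>\<^sup>+x. ennreal (exp (- a * x)) * indicator {c..} x \<partial>lborel) = ennreal (- (0 / a) - (- (exp (- a * c) / a)))"
  proof (rule nn_integral_FTC_atLeast[OF _ _ _ lim])
    show "((\<lambda>x. - (exp (- a * x) / a)) has_real_derivative exp (- a * x)) (at x)" for x
      using a by (auto intro!: derivative_eq_intros)
  qed simp_all
  moreover have "ennreal (exp (- a * x) * indicator {c..} x) = ennreal (exp (- a * x)) * indicator {c..} x" for x
    by (simp add: indicator_def)
  ultimately show "(\<integral>\<^sup>+x. ennreal (exp (- a * x) * indicator {c..} x) \<partial>lborel) = ennreal (exp (- a * c) / a)"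
    by simp
  show "0 \<le> exp (- a * c) / a" using a by simp
qed simp_all

text \<open>Stationary solution for a loss rate frozen at
  \<open>\<mu> + \<kappa> * indicator {\<tau>..} s\<close>, with value \<open>b\<close> at seniority
  0 if \<open>\<tau> \<ge> 0\<close>. For \<open>\<kappa> = 0\<close> it is the pure exponential, so
  one formula covers the top level too.\<close>

definition profile :: "real \<Rightarrow> real \<Rightarrow> real \<Rightarrow> real \<Rightarrow> real \<Rightarrow> real" where
  "profile \<mu> b \<tau> \<kappa> s = exp (- \<mu> * s - \<kappa> * max (s - \<tau>) 0) * b"

lemma profile_continuous: "continuous_on S (profile \<mu> b \<tau> \<kappa>)"
  unfolding profile_def[abs_def] by (intro continuous_intros)

lemma profile_measurable [measurable]: "profile \<mu> b \<tau> \<kappa> \<in> borel_measurable borel"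
  by (rule borel_measurable_continuous_onI[OF profile_continuous])

lemma profile_nonneg: "b \<ge> 0 \<Longrightarrow> profile \<mu> b \<tau> \<kappa> s \<ge> 0"
  by (simp add: profile_def)

lemma profile_DERIV:
  assumes "s \<noteq> \<tau>"
  shows "(profile \<mu> b \<tau> \<kappa> has_real_derivative
    - (\<mu> + \<kappa> * indicator {\<tau>..} s) * profile \<mu> b \<tau> \<kappa> s) (at s)"
proof (cases "s > \<tau>")
  case True
  have "((\<lambda>s. exp (- \<mu> * s - \<kappa> * (s - \<tau>)) * b) has_real_derivative
      - (\<mu> + \<kappa> * indicator {\<tau>..} s) * profile \<mu> b \<tau> \<kappa> s) (at s)"
    using True by (auto intro!: derivative_eq_intros simp: profile_def algebra_simps)
  then show ?thesis
    by (rule has_field_derivative_transform_within_open[where S="{\<tau><..}"]) (use True in \<open>auto simp: profile_def\<close>)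
next
  case False
  then have lt: "s < \<tau>" using assms by simp
  have "((\<lambda>s. exp (- \<mu> * s) * b) has_real_derivative
      - (\<mu> + \<kappa> * indicator {\<tau>..} s) * profile \<mu> b \<tau> \<kappa> s) (at s)"
    using lt by (auto intro!: derivative_eq_intros simp: profile_def)
  then show ?thesis
    by (rule has_field_derivative_transform_within_open[where S="{..<\<tau>}"]) (use lt in \<open>auto simp: profile_def\<close>)
qed

lemma profile_integrable:
  assumes "\<mu> > 0" "b \<ge> 0" "\<kappa> \<ge> 0"
  shows "set_integrable lborel {0..} (profile \<mu> b \<tau> \<kappa>)"
  unfolding set_integrable_def
proof (rule Bochner_Integration.integrable_bound)
  show "integrable lborel (\<lambda>s. b * (exp (- \<mu> * s) * indicator {0..} s))"
    using has_bochner_integral_exp_half_line[OF assms(1), of 0] by (auto simp: has_bochner_integral_iff)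
  have "profile \<mu> b \<tau> \<kappa> s \<le> b * exp (- \<mu> * s)" for s
  proof -
    have "exp (- \<mu> * s - \<kappa> * max (s - \<tau>) 0) \<le> exp (- \<mu> * s)"
      using assms(3) by simp
    from mult_right_mono[OF this assms(2)] show ?thesis by (simp add: profile_def mult.commute)
  qed
  then show "AE s in lborel. norm (indicator {0..} s *\<^sub>R profile \<mu> b \<tau> \<kappa> s) \<le> norm (b * (exp (- \<mu> * s) * indicator {0..} s))"
    using assms(2) profile_nonneg[OF assms(2)] by (intro AE_I2) (simp add: indicator_def)
qed simp

lemma profile_tail:
  assumes "\<mu> > 0" "\<kappa> \<ge> 0"
  shows "(LINT s:{\<tau>..}|lborel. profile \<mu> b \<tau> \<kappa> s) = b * exp (- \<mu> * \<tau>) / (\<mu> + \<kappa>)"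
proof -
  have pos: "\<mu> + \<kappa> > 0" using assms by simp
  have "(LINT s:{\<tau>..}|lborel. profile \<mu> b \<tau> \<kappa> s)
      = (LINT s|lborel. (b * exp (\<kappa> * \<tau>)) * (exp (- (\<mu> + \<kappa>) * s) * indicator {\<tau>..} s))"
    unfolding set_lebesgue_integral_def
    by (intro Bochner_Integration.integral_cong)
       (auto simp: profile_def indicator_def exp_add[symmetric] algebra_simps)
  also have "\<dots> = (b * exp (\<kappa> * \<tau>)) * (exp (- (\<mu> + \<kappa>) * \<tau>) / (\<mu> + \<kappa>))"
    using has_bochner_integral_exp_half_line[OF pos, of \<tau>]
    by (simp only: integral_mult_right_zero has_bochner_integral_integral_eq)
  also have "\<dots> = b * (exp (\<kappa> * \<tau>) * exp (- (\<mu> + \<kappa>) * \<tau>)) / (\<mu> + \<kappa>)"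
    by simp
  also have "exp (\<kappa> * \<tau>) * exp (- (\<mu> + \<kappa>) * \<tau>) = exp (- \<mu> * \<tau>)"
    by (simp add: exp_add[symmetric] algebra_simps)
  finally show ?thesis .
qed

text \<open>\<open>test_function\<close> bounds only the support of \<open>\<phi>\<close>, whereas
  the weak formulation also contains the partial derivatives. Each of these is the derivative of a
  one-variable function that vanishes near the point in question.\<close>

lemma test_function_vanish:
  assumes "test_function \<phi> \<phi>t \<phi>s"
  obtains B where "B > 0"
    "\<And>t s. \<bar>t\<bar> > B \<or> \<bar>s\<bar> > B \<Longrightarrow> \<phi> t s = 0 \<and> \<phi>t t s = 0 \<and> \<phi>s t s = 0"
proof -
  obtain B where B: "B > 0" "\<And>z. z \<in> {(t, s). \<phi> t s \<noteq> 0} \<Longrightarrow> norm z \<le> B"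
    using assms unfolding test_function_def bounded_pos by blast
  have z: "\<phi> t s = 0" if "\<bar>t\<bar> > B \<or> \<bar>s\<bar> > B" for t s
  proof (rule ccontr)
    assume "\<phi> t s \<noteq> 0"
    then have "norm (t, s) \<le> B" using B(2)[of "(t, s)"] by simp
    moreover have "\<bar>t\<bar> \<le> norm (t, s)" "\<bar>s\<bar> \<le> norm (t, s)"
      using norm_fst_le[of t s] norm_snd_le[of s t] by simp_all
    ultimately show False using that by linarith
  qed
  have loc: "f' = 0" if "(f has_real_derivative f') (at x)" "open U" "x \<in> U" "\<And>y. y \<in> U \<Longrightarrow> f y = 0"
    for f :: "real \<Rightarrow> real" and f' x U
  proof -
    have "(f has_real_derivative 0) (at x)"
      by (rule has_field_derivative_transform_within_open[of "\<lambda>x. 0" 0 x U]) (use that in auto)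
    with that(1) show ?thesis by (rule DERIV_unique)
  qed
  have o: "open {x::real. \<bar>x\<bar> > B}"
    by (intro open_Collect_less continuous_intros)
  have dt: "((\<lambda>x. \<phi> x s) has_real_derivative \<phi>t t s) (at t)"
    and ds: "((\<lambda>x. \<phi> t x) has_real_derivative \<phi>s t s) (at s)" for t s
    using assms unfolding test_function_def by blast+
  have "\<phi>t t s = 0 \<and> \<phi>s t s = 0" if "\<bar>t\<bar> > B \<or> \<bar>s\<bar> > B" for t s
    using that
  proof
    assume t: "\<bar>t\<bar> > B"
    show ?thesis
      using loc[OF dt[of s t] o, simplified, OF t] loc[OF ds[of t s] open_UNIV] t z by auto
  next
    assume s: "\<bar>s\<bar> > B"
    show ?thesis
      using loc[OF ds[of t s] o, simplified, OF s] loc[OF dt[of s t] open_UNIV] s z by auto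
  qed
  then show ?thesis using that[OF B(1)] z by blast
qed

lemma profile_weak_transport:
  assumes tau: "\<tau> \<ge> 0"
  shows "weak_transport (\<lambda>t s. \<mu> + \<kappa> * indicator {\<tau>..} s) b (\<lambda>t. profile \<mu> b \<tau> \<kappa>)"
  unfolding weak_transport_def
proof (intro allI impI)
  fix \<phi> \<phi>t \<phi>s assume test: "test_function \<phi> \<phi>t \<phi>s"
  obtain B where B: "B > 0" and
    z: "\<And>t s. \<bar>t\<bar> > B \<or> \<bar>s\<bar> > B \<Longrightarrow> \<phi> t s = 0 \<and> \<phi>t t s = 0 \<and> \<phi>s t s = 0"
    using test_function_vanish[OF test] by blast
  define S where "S = B + 1"
  have S: "S > 0" "B < S" using B by (auto simp: S_def)
  have z': "\<phi> t s = 0" "\<phi>t t s = 0" "\<phi>s t s = 0" if "t > B \<or> s > B" for t s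
    using z[of t s] that B by auto
  define \<sigma> where "\<sigma> = profile \<mu> b \<tau> \<kappa>"
  have c\<sigma>: "continuous_on X \<sigma>" for X unfolding \<sigma>_def by (rule profile_continuous)
  have \<sigma>0: "\<sigma> 0 = b" using tau by (simp add: \<sigma>_def profile_def)
  have dt: "((\<lambda>x. \<phi> x s) has_real_derivative \<phi>t t s) (at t)"
    and ds: "((\<lambda>x. \<phi> t x) has_real_derivative \<phi>s t s) (at s)" for t s
    using test unfolding test_function_def by blast+
  have ct: "continuous_on X (\<lambda>x. \<phi> x s)" and cs: "continuous_on X (\<lambda>x. \<phi> t x)" for t s X
    by (rule DERIV_continuous_on[OF has_field_derivative_at_within[OF dt]]
             DERIV_continuous_on[OF has_field_derivative_at_within[OF ds]])+
  have c\<phi>t: "continuous_on UNIV (\<lambda>z. \<phi>t (fst z) (snd z))" and c\<phi>s: "continuous_on UNIV (\<lambda>z. \<phi>s (fst z) (snd z))"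
    using test unfolding test_function_def case_prod_beta by blast+
  have cp: "continuous_on X (\<lambda>s::real. (t::real, s))" "continuous_on X (\<lambda>t::real. (t, s::real))" for X t s
    by (intro continuous_on_Pair continuous_on_const continuous_on_id)+
  have ctt: "continuous_on X (\<phi>t t)" and css: "continuous_on X (\<phi>s t)" and ctt': "continuous_on X (\<lambda>t. \<phi>t t s)" for X t s
    using continuous_on_compose2[OF c\<phi>t cp(1) subset_UNIV] continuous_on_compose2[OF c\<phi>s cp(1) subset_UNIV]
      continuous_on_compose2[OF c\<phi>t cp(2) subset_UNIV]
    by simp_all
  have c2: "continuous_on X (\<lambda>(t, s). \<sigma> s * \<phi>t t s)" for X
    unfolding case_prod_beta
    by (rule continuous_on_mult[OF continuous_on_compose2[OF c\<sigma>[of UNIV] continuous_on_snd[OF continuous_on_id]]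
          continuous_on_subset[OF c\<phi>t]]) auto
  define g where "g t = integral {0..S} (\<lambda>s. \<sigma> s * \<phi>t t s)" for t
  have cg: "continuous_on X g" for X
    using integral_continuous_on_param[of X 0 S "\<lambda>t s. \<sigma> s * \<phi>t t s", OF c2] by (simp add: g_def[abs_def])
  have inner: "(LINT s:{0..}|lborel. \<sigma> s * (\<phi>t t s + \<phi>s t s - (\<mu> + \<kappa> * indicator {\<tau>..} s) * \<phi> t s))
      = g t - b * \<phi> t 0" for t
  proof -
    have i0: "set_integrable lborel {0..S} (\<lambda>s. \<sigma> s * \<phi> t s)"
      by (rule borel_integrable_atLeastAtMost'[OF continuous_on_mult[OF c\<sigma> cs]])
    have i1: "set_integrable lborel {0..S} (\<lambda>s. \<sigma> s * (\<phi>s t s - \<mu> * \<phi> t s))"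
      by (rule borel_integrable_atLeastAtMost'[OF continuous_on_mult[OF c\<sigma>
            continuous_on_diff[OF css continuous_on_mult[OF continuous_on_const cs]]]])
    have i2: "set_integrable lborel {0..S} (\<lambda>s. \<kappa> * (\<sigma> s * \<phi> t s * indicator {\<tau>..} s))"
    proof -
      have "integrable lborel (\<lambda>s. \<kappa> * (indicator {0..S} s *\<^sub>R (\<sigma> s * \<phi> t s) * indicator {\<tau>..} s))"
        using i0 unfolding set_integrable_def by (intro integrable_mult_right integrable_real_mult_indicator) simp_all
      then show ?thesis unfolding set_integrable_def by (simp add: mult_ac)
    qed
    let ?f = "\<lambda>s. \<sigma> s * (\<phi>s t s - \<mu> * \<phi> t s) - \<kappa> * (\<sigma> s * \<phi> t s * indicator {\<tau>..} s)"
    have i3: "set_integrable lborel {0..S} ?f"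
      by (rule set_integral_diff(1)[OF i1 i2])
    have i4: "set_integrable lborel {0..S} (\<lambda>s. \<sigma> s * \<phi>t t s)"
      by (rule borel_integrable_atLeastAtMost'[OF continuous_on_mult[OF c\<sigma> ctt]])
    \<comment> \<open>The kink of the profile at \<tau> is the only point where the product may fail
      to be differentiable.\<close>
    have "(?f has_integral \<sigma> S * \<phi> t S - \<sigma> 0 * \<phi> t 0) {0..S}"
    proof (rule fundamental_theorem_of_calculus_interior_strong[of "{\<tau>}"])
      show "((\<lambda>s. \<sigma> s * \<phi> t s) has_vector_derivative ?f s) (at s)" if "s \<in> {0<..<S} - {\<tau>}" for s
      proof -
        have "s \<noteq> \<tau>" using that by simp
        from DERIV_mult[OF profile_DERIV[OF this, of \<mu> b \<kappa>] ds[of t s]]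
        show ?thesis
          unfolding has_real_derivative_iff_has_vector_derivative[symmetric] \<sigma>_def
          by (rule DERIV_cong) (simp add: algebra_simps)
      qed
      show "continuous_on {0..S} (\<lambda>s. \<sigma> s * \<phi> t s)"
        by (rule continuous_on_mult[OF c\<sigma> cs])
    qed (use S in auto)
    then have "integral {0..S} ?f = - b * \<phi> t 0"
      using z'[of t S] S \<sigma>0 by (simp add: integral_unique)
    then have e3: "(LINT s:{0..S}|lborel. ?f s) = - b * \<phi> t 0"
      using set_borel_integral_eq_integral(2)[OF i3] by simp
    have e4: "(LINT s:{0..S}|lborel. \<sigma> s * \<phi>t t s) = g t"
      using set_borel_integral_eq_integral(2)[OF i4] by (simp add: g_def)
    have "(LINT s:{0..}|lborel. \<sigma> s * (\<phi>t t s + \<phi>s t s - (\<mu> + \<kappa> * indicator {\<tau>..} s) * \<phi> t s))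
      = (LINT s:{0..S}|lborel. \<sigma> s * \<phi>t t s + ?f s)"
      unfolding set_lebesgue_integral_def
    proof (rule Bochner_Integration.integral_cong[OF refl])
      fix s
      show "indicator {0..} s *\<^sub>R (\<sigma> s * (\<phi>t t s + \<phi>s t s - (\<mu> + \<kappa> * indicator {\<tau>..} s) * \<phi> t s))
        = indicator {0..S} s *\<^sub>R (\<sigma> s * \<phi>t t s + ?f s)"
      proof (cases "s > S")
        case True
        then have "\<phi> t s = 0" "\<phi>t t s = 0" "\<phi>s t s = 0" using z'[of t s] S by auto
        then show ?thesis by simp
      next
        case False
        then have "indicator {0..} s = (indicator {0..S} s :: real)" by (simp add: indicator_def)
        then show ?thesis by (simp add: algebra_simps)
      qed
    qed
    also have "\<dots> = g t - b * \<phi> t 0"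
      using set_integral_add(2)[OF i4 i3] e3 e4 by simp
    finally show ?thesis .
  qed
  have c0: "continuous_on X (\<lambda>t. b * \<phi> t 0)" for X
    by (rule continuous_on_mult[OF continuous_on_const ct])
  have g0: "g t = 0" if "t > S" for t
  proof -
    have "g t = integral {0..S} (\<lambda>s. 0)"
      unfolding g_def using that S by (intro Henstock_Kurzweil_Integration.integral_cong) (simp add: z')
    then show ?thesis by simp
  qed
  have "(LINT t:{0..}|lborel. g t - b * \<phi> t 0) = integral {0..S} (\<lambda>t. g t - b * \<phi> t 0)"
    by (rule LINT_half_line_eq_integral[OF continuous_on_diff[OF cg c0]]) (use S g0 z' in simp)
  also have "\<dots> = integral {0..S} g - integral {0..S} (\<lambda>t. b * \<phi> t 0)"
    by (rule Henstock_Kurzweil_Integration.integral_diff[OF integrable_continuous_real[OF cg] integrable_continuous_real[OF c0]])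
  finally have e1: "(LINT t:{0..}|lborel. g t - b * \<phi> t 0) = integral {0..S} g - integral {0..S} (\<lambda>t. b * \<phi> t 0)" .
  have e2: "(LINT t:{0..}|lborel. b * \<phi> t 0) = integral {0..S} (\<lambda>t. b * \<phi> t 0)"
    by (rule LINT_half_line_eq_integral[OF c0]) (use S z' in simp)
  have e3: "(LINT s:{0..}|lborel. \<sigma> s * \<phi> 0 s) = integral {0..S} (\<lambda>s. \<sigma> s * \<phi> 0 s)"
    by (rule LINT_half_line_eq_integral[OF continuous_on_mult[OF c\<sigma> cs]]) (use S z' in simp)
  \<comment> \<open>After the exchange, the inner integral of \<open>\<phi>t\<close> over
    \<open>{0..S}\<close> is \<open>- \<phi> 0 s\<close>, since \<open>\<phi>\<close> is 0 at time
    \<open>S\<close>.\<close>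
  have "integral {0..S} g = integral {0..S} (\<lambda>s. integral {0..S} (\<lambda>t. \<sigma> s * \<phi>t t s))"
    using integral_swap_continuous[of 0 0 S S "\<lambda>t s. \<sigma> s * \<phi>t t s", OF c2] by (simp add: g_def[abs_def])
  also have "\<dots> = integral {0..S} (\<lambda>s. - (\<sigma> s * \<phi> 0 s))"
  proof (rule Henstock_Kurzweil_Integration.integral_cong)
    fix s
    have "((\<lambda>t. \<phi>t t s) has_integral \<phi> S s - \<phi> 0 s) {0..S}"
    proof (rule fundamental_theorem_of_calculus)
      show "((\<lambda>t. \<phi> t s) has_vector_derivative \<phi>t t s) (at t within {0..S})" for t
        unfolding has_real_derivative_iff_has_vector_derivative[symmetric]
        by (rule has_field_derivative_at_within[OF dt])
    qed (use S in simp)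
    then show "integral {0..S} (\<lambda>t. \<sigma> s * \<phi>t t s) = - (\<sigma> s * \<phi> 0 s)"
      using z'[of S s] S by (simp add: integral_unique)
  qed
  finally have e4: "integral {0..S} g = - integral {0..S} (\<lambda>s. \<sigma> s * \<phi> 0 s)" by simp
  show "(LINT t:{0..}|lborel. (LINT s:{0..}|lborel.
           profile \<mu> b \<tau> \<kappa> s * (\<phi>t t s + \<phi>s t s - (\<mu> + \<kappa> * indicator {\<tau>..} s) * \<phi> t s)))
        + (LINT s:{0..}|lborel. profile \<mu> b \<tau> \<kappa> s * \<phi> 0 s)
        + (LINT t:{0..}|lborel. b * \<phi> t 0) = 0"
    unfolding \<sigma>_def[symmetric] inner e1 e2 e3 e4 by simp
qed

lemma profile_in_C_L1:
  assumes "\<mu> > 0" "b \<ge> 0" "\<kappa> \<ge> 0"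
  shows "in_C_L1 (\<lambda>t. profile \<mu> b \<tau> \<kappa>)"
proof -
  have "(\<lambda>z::real \<times> real. profile \<mu> b \<tau> \<kappa> (snd z)) \<in> borel_measurable borel"
    by (rule borel_measurable_continuous_onI, rule continuous_on_compose2[OF profile_continuous[of UNIV]])
       (auto intro: continuous_intros)
  moreover have "{0::real..} \<times> {0::real..} \<in> sets borel"
    by (intro borel_closed closed_Times) auto
  ultimately have "set_borel_measurable borel ({0..} \<times> {0..}) (\<lambda>(t::real, s). profile \<mu> b \<tau> \<kappa> s)"
    unfolding set_borel_measurable_def case_prod_beta
    by (intro borel_measurable_scaleR borel_measurable_indicator)
  then show ?thesis
    using profile_integrable[OF assms] by (simp add: in_C_L1_def)
qed

text \<open>Self-consistency of the nonlinearity. Freezing the rate at \<open>K / A0\<close> gives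
  the eligible mass \<open>(\<mu> * N + K) * exp (- \<mu> * \<tau>) / (\<mu> + K / A0)\<close>.
  Equating this with \<open>A0\<close> is the linear equation
  \<open>\<mu> * A0 + K = (\<mu> * N + K) * exp (- \<mu> * \<tau>)\<close>, which is where the
  formula for \<open>A_tilde\<close> comes from.\<close>

lemma profile_job_level:
  fixes \<mu> N K \<tau> :: real
  defines "A0 \<equiv> (\<mu> * N * exp (- \<mu> * \<tau>) - (1 - exp (- \<mu> * \<tau>)) * K) / \<mu>"
  assumes mu: "\<mu> > 0" and N: "N \<ge> 0" and K: "K \<ge> 0" and tau: "\<tau> \<ge> 0" and A0: "K = 0 \<or> A0 > 0"
  shows "job_level \<mu> N K \<tau> (\<lambda>t. profile \<mu> (\<mu> * N + K) \<tau> (K / A0))"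
    and "A0 > 0 \<Longrightarrow> (LINT s:{\<tau>..}|lborel. profile \<mu> (\<mu> * N + K) \<tau> (K / A0) s) = A0"
proof -
  have kap: "K / A0 \<ge> 0" using A0 K by auto
  have b: "\<mu> * N + K \<ge> 0" using mu N K by simp
  show tail: "(LINT s:{\<tau>..}|lborel. profile \<mu> (\<mu> * N + K) \<tau> (K / A0) s) = A0" if "A0 > 0"
  proof -
    have "\<mu> * A0 = \<mu> * N * exp (- \<mu> * \<tau>) - (1 - exp (- \<mu> * \<tau>)) * K"
      using mu by (simp add: A0_def)
    moreover have "A0 * (\<mu> + K / A0) = \<mu> * A0 + K"
      using that by (simp add: field_simps)
    ultimately have "(\<mu> * N + K) * exp (- \<mu> * \<tau>) = A0 * (\<mu> + K / A0)"
      by (simp add: algebra_simps)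
    moreover have "\<mu> + K / A0 > 0" using mu kap by linarith
    ultimately show ?thesis
      unfolding profile_tail[OF mu kap] by (simp add: divide_eq_eq)
  qed
  \<comment> \<open>For \<open>K = 0\<close> both sides are 0 whatever the denominators are;
    otherwise \<open>A0\<close> is positive and \<open>tail\<close> applies.\<close>
  have d: "K / (LINT s:{\<tau>..}|lborel. profile \<mu> (\<mu> * N + K) \<tau> (K / A0) s) = K / A0"
    using A0 tail by auto
  show "job_level \<mu> N K \<tau> (\<lambda>t. profile \<mu> (\<mu> * N + K) \<tau> (K / A0))"
  proof
    show "in_C_L1 (\<lambda>t. profile \<mu> (\<mu> * N + K) \<tau> (K / A0))"
      by (rule profile_in_C_L1[OF mu b kap])
    show "K = 0 \<or> 0 < (LINT s:{\<tau>..}|lborel. profile \<mu> (\<mu> * N + K) \<tau> (K / A0) s)" for t :: real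
      using A0 tail by auto
    show "weak_transport (\<lambda>t s. \<mu> + K / (LINT s:{\<tau>..}|lborel. profile \<mu> (\<mu> * N + K) \<tau> (K / A0) s) * indicator {\<tau>..} s)
        (\<mu> * N + K) (\<lambda>t. profile \<mu> (\<mu> * N + K) \<tau> (K / A0))"
      unfolding d by (rule profile_weak_transport[OF tau])
  qed (use mu K tau in auto)
qed

section \<open>Mass of stationary states, contraction and decay for one level\<close>

lemma (in job_level) mass_0: "mass 0 = (LINT s:{0..}|lborel. r 0 s)"
  by (simp add: mass_def R_def set_lebesgue_integral_def)

text \<open>Over unit time the deviation of the mass from \<open>N\<close> is multiplied by
  \<open>exp (- \<mu>)\<close>, which is not 1, so only the deviation 0 is constant.\<close>

lemma (in job_level) stationary_mass:
  assumes "\<And>t. r t = r 0"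
  shows "(LINT s:{0..}|lborel. r 0 s) = N"
proof -
  have "mass 1 = mass 0" using assms[of 1] by (simp add: mass_def R_def)
  then have "(mass 0 - N) * (1 - exp (- \<mu>)) = 0"
    using mass_eq[of 1] by (simp add: algebra_simps)
  moreover have "1 - exp (- \<mu>) \<noteq> 0" using mu_pos by simp
  ultimately show ?thesis by (simp add: mass_0)
qed

lemma job_level_contraction:
  assumes a: "job_level \<mu> N K \<tau> r" and b: "job_level \<mu> N K \<tau> r'"
    and mass: "(LINT s:{0..}|lborel. r 0 s) = N" "(LINT s:{0..}|lborel. r' 0 s) = N"
    and t0: "0 \<le> t0" "t0 \<le> T"
    and start: "\<tau> \<le> t0 \<or> (AE s in lborel. 0 \<le> s \<longrightarrow> r 0 s = r' 0 s)"
  shows "(LINT s:{0..}|lborel. \<bar>r T s - r' T s\<bar>)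
    \<le> exp (- \<mu> * (T - t0)) * (LINT s:{0..}|lborel. \<bar>r t0 s - r' t0 s\<bar>)"
proof -
  interpret job_level_pair \<mu> N K \<tau> r r'
    using a b by (rule job_level_pair.intro)
  have "\<tau> \<le> t0 \<or> (AE s in lborel. a.R 0 s = b.R 0 s)"
    using start
  proof
    assume "AE s in lborel. 0 \<le> s \<longrightarrow> r 0 s = r' 0 s"
    then have "AE s in lborel. a.R 0 s = b.R 0 s"
      by eventually_elim (auto simp: a.R_def b.R_def indicator_def)
    then show ?thesis ..
  qed simp
  moreover have "a.mass 0 = b.mass 0"
    by (simp add: a.mass_0 b.mass_0 mass)
  moreover have "(LINT s:{0..}|lborel. \<bar>r t s - r' t s\<bar>) = (LINT s|lborel. \<bar>a.R t s - b.R t s\<bar>)" for t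
    unfolding set_lebesgue_integral_def a.R_def b.R_def
    by (intro Bochner_Integration.integral_cong) (auto simp: indicator_def)
  ultimately show ?thesis
    using L1_contraction[OF t0] by simp
qed

lemma L1_dist_eq_0_iff:
  assumes "set_integrable lborel {0..} f" "set_integrable lborel {0..} g"
  shows "(LINT s:{0..}|lborel. \<bar>f s - g s\<bar>) = 0 \<longleftrightarrow> (AE s in lborel. 0 \<le> s \<longrightarrow> f s = (g s :: real))"
proof -
  have "set_integrable lborel {0..} (\<lambda>s. \<bar>f s - g s\<bar>)"
    by (intro set_integrable_abs set_integral_diff assms)
  then have "(LINT s:{0..}|lborel. \<bar>f s - g s\<bar>) = 0
      \<longleftrightarrow> (AE s in lborel. indicator {0..} s *\<^sub>R \<bar>f s - g s\<bar> = 0)"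
    unfolding set_lebesgue_integral_def set_integrable_def
    by (intro integral_nonneg_eq_0_iff_AE) auto
  also have "\<dots> \<longleftrightarrow> (AE s in lborel. 0 \<le> s \<longrightarrow> f s = g s)"
    by (intro AE_cong) (auto simp: indicator_def)
  finally show ?thesis .
qed

lemma job_level_integrable:
  "job_level \<mu> N K \<tau> r \<Longrightarrow> 0 \<le> t \<Longrightarrow> set_integrable lborel {0..} (r t)"
  using job_level.r_C_L1 unfolding in_C_L1_def by blast

text \<open>The constant compares the distances at times \<open>\<tau>\<close> and \<open>0\<close>; it depends on the initial datum
  only, because that datum determines the solution.\<close>

lemma job_level_decay:
  assumes b: "job_level \<mu> N K \<tau> r'" and mass_b: "(LINT s:{0..}|lborel. r' 0 s) = N" and const: "\<And>t. r' t = r' 0"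
    and mass0: "(LINT s:{0..}|lborel. \<rho>0 s) = N" and int0: "set_integrable lborel {0..} \<rho>0"
  shows "\<exists>C\<ge>0. \<forall>r. job_level \<mu> N K \<tau> r \<and> (AE s in lborel. 0 \<le> s \<longrightarrow> r 0 s = \<rho>0 s) \<longrightarrow>
    (\<forall>t\<ge>\<tau>. (LINT s:{0..}|lborel. \<bar>r t s - r' t s\<bar>)
      \<le> C * exp (- \<mu> * t) * (LINT s:{0..}|lborel. \<bar>r 0 s - r' 0 s\<bar>))"
proof (cases "\<exists>r. job_level \<mu> N K \<tau> r \<and> (AE s in lborel. 0 \<le> s \<longrightarrow> r 0 s = \<rho>0 s)")
  case False
  then show ?thesis by (intro exI[of _ 0]) blast
next
  case True
  \<comment> \<open>One solution \<open>q\<close> with the given datum is fixed to define the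
    constant; if there were none, the claim would be vacuous.\<close>
  then obtain q where q: "job_level \<mu> N K \<tau> q" and q0: "AE s in lborel. 0 \<le> s \<longrightarrow> q 0 s = \<rho>0 s"
    by blast
  have tau: "\<tau> \<ge> 0" using q by (simp add: job_level_def)
  have mass: "(LINT s:{0..}|lborel. r 0 s) = N"
    if r: "job_level \<mu> N K \<tau> r" and r0: "AE s in lborel. 0 \<le> s \<longrightarrow> r 0 s = \<rho>0 s" for r
  proof -
    have "AE s in lborel. indicator {0..} s *\<^sub>R r 0 s = indicator {0..} s *\<^sub>R \<rho>0 s"
      using r0 by eventually_elim (auto simp: indicator_def)
    then have "(LINT s:{0..}|lborel. r 0 s) = (LINT s:{0..}|lborel. \<rho>0 s)"
      using job_level_integrable[OF r order_refl] int0
      unfolding set_lebesgue_integral_def set_integrable_def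
      by (intro integral_cong_AE borel_measurable_integrable)
    then show ?thesis using mass0 by simp
  qed
  define d where "d t = (LINT s:{0..}|lborel. \<bar>q t s - r' t s\<bar>)" for t
  have d_nonneg: "d t \<ge> 0" for t
    unfolding d_def set_lebesgue_integral_def by (rule integral_nonneg_AE) simp
  \<comment> \<open>The contraction from time \<tau> gives \<open>d t \<le> exp (\<mu> * \<tau>) *
    exp (- \<mu> * t) * d \<tau>\<close>, and dividing by \<open>d 0\<close> brings the initial
    distance to the right-hand side. For \<open>d 0 = 0\<close> the quotient is 0 by convention, and
    that case is treated apart.\<close>
  define C where "C = exp (\<mu> * \<tau>) * d \<tau> / d 0"
  show ?thesis
  proof (intro exI[of _ C] conjI allI impI)
    show "C \<ge> 0" unfolding C_def using d_nonneg by simp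
    fix r t
    assume "job_level \<mu> N K \<tau> r \<and> (AE s in lborel. 0 \<le> s \<longrightarrow> r 0 s = \<rho>0 s)" and t: "\<tau> \<le> t"
    then have r: "job_level \<mu> N K \<tau> r" and r0: "AE s in lborel. 0 \<le> s \<longrightarrow> r 0 s = \<rho>0 s"
      by auto
    have rq0: "AE s in lborel. 0 \<le> s \<longrightarrow> r 0 s = q 0 s"
      using r0 q0 by eventually_elim simp
    \<comment> \<open>Uniqueness for a given datum: the contraction starts at time 0 from distance
      0. Hence the constant built from \<open>q\<close> serves every \<open>r\<close>.\<close>
    have rq: "AE s in lborel. 0 \<le> s \<longrightarrow> r u s = q u s" if u: "u \<ge> 0" for u
    proof -
      have "(LINT s:{0..}|lborel. \<bar>r 0 s - q 0 s\<bar>) = 0"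
        using rq0 L1_dist_eq_0_iff[OF job_level_integrable[OF r order_refl] job_level_integrable[OF q order_refl]]
        by blast
      then have "(LINT s:{0..}|lborel. \<bar>r u s - q u s\<bar>) \<le> 0"
        using job_level_contraction[OF r q mass[OF r r0] mass[OF q q0] order_refl u] rq0 by simp
      moreover have "(LINT s:{0..}|lborel. \<bar>r u s - q u s\<bar>) \<ge> 0"
        unfolding set_lebesgue_integral_def by (rule integral_nonneg_AE) simp
      ultimately show ?thesis
        using L1_dist_eq_0_iff[OF job_level_integrable[OF r u] job_level_integrable[OF q u]] by linarith
    qed
    have dist: "(LINT s:{0..}|lborel. \<bar>r u s - r' u s\<bar>) = d u" if u: "u \<ge> 0" for u
    proof -
      have "AE s in lborel. indicator {0..} s *\<^sub>R \<bar>r u s - r' u s\<bar> = indicator {0..} s *\<^sub>R \<bar>q u s - r' u s\<bar>"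
        using rq[OF u] by eventually_elim (auto simp: indicator_def)
      moreover have "set_integrable lborel {0..} (\<lambda>s. \<bar>r u s - r' u s\<bar>)" "set_integrable lborel {0..} (\<lambda>s. \<bar>q u s - r' u s\<bar>)"
        by (intro set_integrable_abs set_integral_diff job_level_integrable[OF r u] job_level_integrable[OF q u] job_level_integrable[OF b u])+
      ultimately show ?thesis
        unfolding d_def set_lebesgue_integral_def set_integrable_def
        by (intro integral_cong_AE borel_measurable_integrable)
    qed
    have t_pos: "t \<ge> 0" using tau t by simp
    show "(LINT s:{0..}|lborel. \<bar>r t s - r' t s\<bar>)
      \<le> C * exp (- \<mu> * t) * (LINT s:{0..}|lborel. \<bar>r 0 s - r' 0 s\<bar>)"
    proof (cases "d 0 = 0")
      \<comment> \<open>With equal initial data the contraction may start at time 0 instead of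
        \<tau>, and the distance stays 0.\<close>
      case True
      then have "AE s in lborel. 0 \<le> s \<longrightarrow> r 0 s = r' 0 s"
        using L1_dist_eq_0_iff[OF job_level_integrable[OF r order_refl] job_level_integrable[OF b order_refl]]
          dist[OF order_refl] by simp
      then show ?thesis
        using job_level_contraction[OF r b mass[OF r r0] mass_b order_refl t_pos] dist[OF order_refl] True by simp
    next
      case False
      have "d t \<le> exp (- \<mu> * (t - \<tau>)) * d \<tau>"
        using job_level_contraction[OF r b mass[OF r r0] mass_b tau t] dist[OF tau] dist[OF t_pos] by simp
      also have "exp (- \<mu> * (t - \<tau>)) = exp (\<mu> * \<tau>) * exp (- \<mu> * t)"
        by (simp add: exp_add[symmetric] algebra_simps)
      also have "exp (\<mu> * \<tau>) * exp (- \<mu> * t) * d \<tau> = C * exp (- \<mu> * t) * d 0"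
        using False by (simp add: C_def)
      finally show ?thesis using dist[OF t_pos] dist[OF order_refl] by simp
    qed
  qed
qed

section \<open>Assembling the levels\<close>

theorem proposition2p6:
  fixes L :: nat and \<mu> N \<tau> \<alpha> :: "nat \<Rightarrow> real"
  assumes L: "L \<ge> 2"
    and N_pos: "\<And>j. j \<in> {1..L} \<Longrightarrow> N j > 0"
    and mu_pos: "\<And>j. j \<in> {1..L} \<Longrightarrow> \<mu> j > 0"
    and tau_nonneg: "\<And>j. j \<in> {1..L} \<Longrightarrow> \<tau> j \<ge> 0"
    and alpha_ge1: "\<And>j. j \<in> {1..L} \<Longrightarrow> \<alpha> j \<ge> 1"
    and A_pos: "\<And>j. j \<in> {1..L - 1} \<Longrightarrow> A_tilde L \<mu> N \<tau> \<alpha> j > 0"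
  shows "stationary_state L \<mu> N \<tau> \<alpha> (rho_tilde L \<mu> N \<tau> \<alpha>) \<and>
    (\<forall>\<sigma>. stationary_state L \<mu> N \<tau> \<alpha> \<sigma> \<longrightarrow>
       (\<forall>j\<in>{1..L}. AE s in lborel. 0 \<le> s \<longrightarrow> \<sigma> j s = rho_tilde L \<mu> N \<tau> \<alpha> j s)) \<and>
    (\<forall>\<rho>0 :: nat \<Rightarrow> real \<Rightarrow> real.
       (\<forall>j\<in>{1..L}.
          set_integrable lborel {0..} (\<rho>0 j) \<and>
          (AE s in lborel. 0 \<le> s \<longrightarrow> \<rho>0 j s > 0) \<and>
          (LINT s:{0..}|lborel. \<rho>0 j s) = N j \<and>
          (\<forall>t\<in>{0..\<tau> j}.
             exp (- t * \<mu> j) * (LINT s:{t..\<tau> j}|lborel. \<rho>0 j (s - t))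
             + 1 / \<mu> j * (1 - exp (- \<mu> j * t)) * (\<mu> j * N j + Cst L \<mu> N \<alpha> (j + 1)) < N j))
       \<longrightarrow>
       (\<exists>C. \<forall>\<rho>. weak_solution L \<mu> N \<tau> \<alpha> \<rho> \<and>
              (\<forall>j\<in>{1..L}. AE s in lborel. 0 \<le> s \<longrightarrow> \<rho> j 0 s = \<rho>0 j s) \<longrightarrow>
          (\<forall>j\<in>{1..L}. \<forall>t. t \<ge> Max (\<tau> ` {1..L}) \<longrightarrow>
             (LINT s:{0..}|lborel. \<bar>\<rho> j t s - rho_tilde L \<mu> N \<tau> \<alpha> j s\<bar>)
             \<le> C * exp (- \<mu> j * t)
                 * (LINT s:{0..}|lborel. \<bar>\<rho> j 0 s - rho_tilde L \<mu> N \<tau> \<alpha> j s\<bar>))))"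
proof -
  define K where "K j = Cst L \<mu> N \<alpha> (j + 1)" for j
  let ?A = "A_tilde L \<mu> N \<tau> \<alpha>" and ?\<rho> = "rho_tilde L \<mu> N \<tau> \<alpha>"
  have K_nonneg: "K j \<ge> 0" if "j \<in> {1..L}" for j
    unfolding K_def Cst_def
  proof (intro sum_nonneg mult_nonneg_nonneg prod_nonneg)
    fix l assume l: "l \<in> {j + 1..L}"
    then show "\<mu> l \<ge> 0" "N l \<ge> 0"
      using mu_pos[of l] N_pos[of l] by auto
    show "1 / \<alpha> k \<ge> 0" if "k \<in> {j + 1..l}" for k
      using alpha_ge1[of k] that l by auto
  qed
  \<comment> \<open>The empty sum at \<open>L + 1\<close> makes the top level an instance of
    \<open>job_level\<close> without promotion.\<close>
  have K_L: "K L = 0" by (simp add: K_def Cst_def)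
  have A_pos': "?A j > 0" if "j \<in> {1..<L}" for j
  proof -
    have "j \<in> {1..L - 1}" using that by auto
    then show ?thesis by (rule A_pos)
  qed
  have K_A: "K j = 0 \<or> ?A j > 0" if "j \<in> {1..L}" for j
    using that A_pos'[of j] K_L by (cases "j = L") auto
  have A_eq: "?A j = (\<mu> j * N j * exp (- \<mu> j * \<tau> j) - (1 - exp (- \<mu> j * \<tau> j)) * K j) / \<mu> j" for j
    by (simp add: A_tilde_def K_def)
  \<comment> \<open>For \<open>j = L\<close> the quotient \<open>K j / ?A j\<close> is 0 whatever
    the value of \<open>?A j\<close>, and the profile reduces to the exponential.\<close>
  have rho_eq: "?\<rho> j = profile (\<mu> j) (\<mu> j * N j + K j) (\<tau> j) (K j / ?A j)" for j
    using K_L by (intro ext) (simp add: rho_tilde_def profile_def K_def mult.commute)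
  have rho_level: "job_level (\<mu> j) (N j) (K j) (\<tau> j) (\<lambda>t. ?\<rho> j)" if j: "j \<in> {1..L}" for j
    unfolding rho_eq unfolding A_eq
    using profile_job_level(1)[OF mu_pos[OF j] less_imp_le[OF N_pos[OF j]] K_nonneg[OF j] tau_nonneg[OF j]]
      K_A[OF j] unfolding A_eq by blast
  have rho_A: "(LINT s:{\<tau> j..}|lborel. ?\<rho> j s) = ?A j" if j: "j \<in> {1..L}" and A: "?A j > 0" for j
    unfolding rho_eq unfolding A_eq
    using profile_job_level(2)[OF mu_pos[OF j] less_imp_le[OF N_pos[OF j]] K_nonneg[OF j] tau_nonneg[OF j]]
      A unfolding A_eq by blast
  have level: "job_level (\<mu> j) (N j) (K j) (\<tau> j) (\<rho> j)"
    if \<rho>: "weak_solution L \<mu> N \<tau> \<alpha> \<rho>" and j: "j \<in> {1..L}" for \<rho> j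
  proof
    show "in_C_L1 (\<rho> j)" using \<rho> j by (simp add: weak_solution_def)
    show "K j = 0 \<or> 0 < (LINT s:{\<tau> j..}|lborel. \<rho> j t s)" if "0 \<le> t" for t
      using \<rho> j that K_L by (cases "j = L") (auto simp: weak_solution_def eligible_def)
    show "weak_transport (\<lambda>t s. \<mu> j + K j / (LINT s:{\<tau> j..}|lborel. \<rho> j t s) * indicator {\<tau> j..} s)
        (\<mu> j * N j + K j) (\<rho> j)"
    proof (cases "j = L")
      case True
      then show ?thesis using \<rho> K_L by (simp add: weak_solution_def)
    next
      case False
      then show ?thesis using \<rho> j by (simp add: weak_solution_def eligible_def K_def)
    qed
  qed (use mu_pos tau_nonneg K_nonneg j in auto)
  have rho_mass: "(LINT s:{0..}|lborel. ?\<rho> j s) = N j" if j: "j \<in> {1..L}" for j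
    using job_level.stationary_mass[OF rho_level[OF j]] by simp
  have "weak_solution L \<mu> N \<tau> \<alpha> (\<lambda>j t s. ?\<rho> j s)"
    unfolding weak_solution_def
  proof (intro conjI ballI allI impI)
    show "in_C_L1 (\<lambda>t. ?\<rho> j)" if "j \<in> {1..L}" for j
      using rho_level[OF that] by (rule job_level.r_C_L1)
    show "eligible \<tau> (\<lambda>j t s. ?\<rho> j s) j t > 0" if "j \<in> {1..<L}" for j t
      using that A_pos'[of j] rho_A[of j] by (auto simp: eligible_def)
    have "L \<in> {1..L}" using L by simp
    from job_level.r_weak[OF rho_level[OF this]]
    show "weak_transport (\<lambda>t s. \<mu> L) (\<mu> L * N L) (\<lambda>t. ?\<rho> L)"
      by (simp add: K_L)
    show "weak_transport
          (\<lambda>t s. \<mu> j + Cst L \<mu> N \<alpha> (j + 1) / eligible \<tau> (\<lambda>j t s. ?\<rho> j s) j t * indicator {\<tau> j..} s)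
          (\<mu> j * N j + Cst L \<mu> N \<alpha> (j + 1)) (\<lambda>t. ?\<rho> j)" if "j \<in> {1..<L}" for j
      using job_level.r_weak[OF rho_level[of j]] that by (simp add: eligible_def K_def)
  qed
  moreover have "0 \<le> ?\<rho> j s" if j: "j \<in> {1..L}" for j s
    unfolding rho_eq
    using mu_pos[OF j] N_pos[OF j] K_nonneg[OF j] by (intro profile_nonneg) simp
  ultimately have 1: "stationary_state L \<mu> N \<tau> \<alpha> ?\<rho>"
    by (simp add: stationary_state_def)
  have 2: "AE s in lborel. 0 \<le> s \<longrightarrow> \<sigma> j s = ?\<rho> j s"
    if \<sigma>: "stationary_state L \<mu> N \<tau> \<alpha> \<sigma>" and j: "j \<in> {1..L}" for \<sigma> j
  proof -
    have lev: "job_level (\<mu> j) (N j) (K j) (\<tau> j) (\<lambda>t. \<sigma> j)"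
      using level[of "\<lambda>j t. \<sigma> j"] \<sigma> j by (simp add: stationary_state_def)
    have mass: "(LINT s:{0..}|lborel. \<sigma> j s) = N j"
      using job_level.stationary_mass[OF lev] by simp
    define d where "d = (LINT s:{0..}|lborel. \<bar>\<sigma> j s - ?\<rho> j s\<bar>)"
    \<comment> \<open>Both solutions are time-independent, so contraction from
      \<open>\<tau> j\<close> to \<open>\<tau> j + 1\<close> bounds their distance by
      \<open>exp (- \<mu> j)\<close> times itself.\<close>
    have "d \<le> exp (- \<mu> j * (\<tau> j + 1 - \<tau> j)) * d"
      unfolding d_def
      by (rule job_level_contraction[OF lev rho_level[OF j] mass rho_mass[OF j] tau_nonneg[OF j]]) simp_all
    then have "(1 - exp (- \<mu> j)) * d \<le> 0" by (simp add: algebra_simps)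
    moreover have "1 - exp (- \<mu> j) > 0" using mu_pos[OF j] by simp
    ultimately have "d \<le> 0" by (simp add: mult_le_0_iff)
    moreover have "d \<ge> 0"
      unfolding d_def set_lebesgue_integral_def by (rule integral_nonneg_AE) simp
    ultimately show ?thesis
      using L1_dist_eq_0_iff[OF job_level_integrable[OF lev order_refl] job_level_integrable[OF rho_level[OF j] order_refl]]
      unfolding d_def by linarith
  qed
  have 3: "\<exists>C. \<forall>\<rho>. weak_solution L \<mu> N \<tau> \<alpha> \<rho> \<and> (\<forall>j\<in>{1..L}. AE s in lborel. 0 \<le> s \<longrightarrow> \<rho> j 0 s = \<rho>0 j s) \<longrightarrow>
          (\<forall>j\<in>{1..L}. \<forall>t. t \<ge> Max (\<tau> ` {1..L}) \<longrightarrow>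
             (LINT s:{0..}|lborel. \<bar>\<rho> j t s - ?\<rho> j s\<bar>)
             \<le> C * exp (- \<mu> j * t) * (LINT s:{0..}|lborel. \<bar>\<rho> j 0 s - ?\<rho> j s\<bar>))"
    if \<rho>0: "\<forall>j\<in>{1..L}. set_integrable lborel {0..} (\<rho>0 j) \<and> (LINT s:{0..}|lborel. \<rho>0 j s) = N j"
    for \<rho>0 :: "nat \<Rightarrow> real \<Rightarrow> real"
  proof -
    have "\<forall>j\<in>{1..L}. \<exists>C\<ge>0. \<forall>r. job_level (\<mu> j) (N j) (K j) (\<tau> j) r \<and> (AE s in lborel. 0 \<le> s \<longrightarrow> r 0 s = \<rho>0 j s) \<longrightarrow>
      (\<forall>t\<ge>\<tau> j. (LINT s:{0..}|lborel. \<bar>r t s - ?\<rho> j s\<bar>)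
        \<le> C * exp (- \<mu> j * t) * (LINT s:{0..}|lborel. \<bar>r 0 s - ?\<rho> j s\<bar>))"
    proof
      fix j assume j: "j \<in> {1..L}"
      show "\<exists>C\<ge>0. \<forall>r. job_level (\<mu> j) (N j) (K j) (\<tau> j) r \<and> (AE s in lborel. 0 \<le> s \<longrightarrow> r 0 s = \<rho>0 j s) \<longrightarrow>
        (\<forall>t\<ge>\<tau> j. (LINT s:{0..}|lborel. \<bar>r t s - ?\<rho> j s\<bar>)
          \<le> C * exp (- \<mu> j * t) * (LINT s:{0..}|lborel. \<bar>r 0 s - ?\<rho> j s\<bar>))"
        by (rule job_level_decay[OF rho_level[OF j] rho_mass[OF j] refl]) (use \<rho>0 j in auto)
    qed
    from bchoice[OF this] obtain C where C: "\<And>j. j \<in> {1..L} \<Longrightarrow> C j \<ge> 0 \<and>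
      (\<forall>r. job_level (\<mu> j) (N j) (K j) (\<tau> j) r \<and> (AE s in lborel. 0 \<le> s \<longrightarrow> r 0 s = \<rho>0 j s) \<longrightarrow>
      (\<forall>t\<ge>\<tau> j. (LINT s:{0..}|lborel. \<bar>r t s - ?\<rho> j s\<bar>)
        \<le> C j * exp (- \<mu> j * t) * (LINT s:{0..}|lborel. \<bar>r 0 s - ?\<rho> j s\<bar>)))"
      by blast
    \<comment> \<open>Each level has its own constant; since all of them are nonnegative, their sum
      dominates each one.\<close>
    show ?thesis
    proof (intro exI[of _ "sum C {1..L}"] allI impI ballI)
      fix \<rho> j t
      assume \<rho>: "weak_solution L \<mu> N \<tau> \<alpha> \<rho> \<and> (\<forall>j\<in>{1..L}. AE s in lborel. 0 \<le> s \<longrightarrow> \<rho> j 0 s = \<rho>0 j s)"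
        and j: "j \<in> {1..L}" and t: "t \<ge> Max (\<tau> ` {1..L})"
      have "\<tau> j \<le> Max (\<tau> ` {1..L})" using j by (intro Max_ge) auto
      then have "\<tau> j \<le> t" using t by simp
      moreover have "job_level (\<mu> j) (N j) (K j) (\<tau> j) (\<rho> j)" using level \<rho> j by blast
      moreover have "AE s in lborel. 0 \<le> s \<longrightarrow> \<rho> j 0 s = \<rho>0 j s" using \<rho> j by blast
      ultimately have "(LINT s:{0..}|lborel. \<bar>\<rho> j t s - ?\<rho> j s\<bar>)
        \<le> C j * exp (- \<mu> j * t) * (LINT s:{0..}|lborel. \<bar>\<rho> j 0 s - ?\<rho> j s\<bar>)"
        using C[OF j] by blast
      also have "\<dots> \<le> sum C {1..L} * exp (- \<mu> j * t) * (LINT s:{0..}|lborel. \<bar>\<rho> j 0 s - ?\<rho> j s\<bar>)"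
      proof (intro mult_right_mono)
        show "C j \<le> sum C {1..L}" using C j by (intro member_le_sum) auto
        show "0 \<le> (LINT s:{0..}|lborel. \<bar>\<rho> j 0 s - ?\<rho> j s\<bar>)"
          unfolding set_lebesgue_integral_def by (rule integral_nonneg_AE) simp
      qed simp
      finally show "(LINT s:{0..}|lborel. \<bar>\<rho> j t s - ?\<rho> j s\<bar>)
        \<le> sum C {1..L} * exp (- \<mu> j * t) * (LINT s:{0..}|lborel. \<bar>\<rho> j 0 s - ?\<rho> j s\<bar>)" .
    qed
  qed
  show ?thesis
  proof (intro conjI allI impI ballI)
    show "stationary_state L \<mu> N \<tau> \<alpha> ?\<rho>" by (rule 1)
  next
    fix \<sigma> j assume "stationary_state L \<mu> N \<tau> \<alpha> \<sigma>" "j \<in> {1..L}"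
    then show "AE s in lborel. 0 \<le> s \<longrightarrow> \<sigma> j s = ?\<rho> j s" by (rule 2)
  next
    fix \<rho>0 :: "nat \<Rightarrow> real \<Rightarrow> real"
    assume "\<forall>j\<in>{1..L}.
          set_integrable lborel {0..} (\<rho>0 j) \<and>
          (AE s in lborel. 0 \<le> s \<longrightarrow> \<rho>0 j s > 0) \<and>
          (LINT s:{0..}|lborel. \<rho>0 j s) = N j \<and>
          (\<forall>t\<in>{0..\<tau> j}.
             exp (- t * \<mu> j) * (LINT s:{t..\<tau> j}|lborel. \<rho>0 j (s - t))
             + 1 / \<mu> j * (1 - exp (- \<mu> j * t)) * (\<mu> j * N j + Cst L \<mu> N \<alpha> (j + 1)) < N j)"
    then have "\<forall>j\<in>{1..L}. set_integrable lborel {0..} (\<rho>0 j) \<and> (LINT s:{0..}|lborel. \<rho>0 j s) = N j"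
      by simp
    then show "\<exists>C. \<forall>\<rho>. weak_solution L \<mu> N \<tau> \<alpha> \<rho> \<and>
              (\<forall>j\<in>{1..L}. AE s in lborel. 0 \<le> s \<longrightarrow> \<rho> j 0 s = \<rho>0 j s) \<longrightarrow>
          (\<forall>j\<in>{1..L}. \<forall>t. t \<ge> Max (\<tau> ` {1..L}) \<longrightarrow>
             (LINT s:{0..}|lborel. \<bar>\<rho> j t s - ?\<rho> j s\<bar>)
             \<le> C * exp (- \<mu> j * t)
                 * (LINT s:{0..}|lborel. \<bar>\<rho> j 0 s - ?\<rho> j s\<bar>))"
      by (rule 3)
  qed
qed

end
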